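(* Let $n\ge1$, $p>1$, $\varepsilon>0$. Let $b$ be an effective damping, let $m$ be a mass dominated by $b$, suppose that $(b,m)$ satisfies the intrinsic accumulated-mass balance (with finite lower index $\beta\in[0,\infty)$ and some $T_0\ge 0$) and the global Liouville nonoscillation condition. Let $\rho$ be the positive slow adjoint solution described in the context, and let $f,g\in L^1(\mathbb R^n)$ satisfy $\mathcal J_0>0$, where $$\mathcal J_0:=\rho(0)\int_{\mathbb R^n}g(x)\,dx+\bigl(b(0)\rho(0)-\rho'(0)\bigr)\int_{\mathbb R^n}f(x)\,dx.$$ Set $$\theta:=\frac1{p-1}-\frac n2-\beta .$$ Suppose that $\theta\ge0$ and $$\int_2^\infty R^{-1+(p-1)\theta}\exp\bigl(-(p-1)\Omega_{\beta,T_0}(\log R)\bigr)\,dR=\infty .$$ Then no global weak solution (that is, no weak solution on $[0,\infty)$) of the Cauchy problem $$u_{tt}-\Delta u+b(t)u_t+m^2(t)u=|u|^p,\qquad u(0,x)=\varepsilon f(x),\quad u_t(0,x)=\varepsilon g(x)$$ exists. More precisely, there are constants $R_0\ge2$ and $C>0$, depending on $n$, $p$, the coefficients ($b,m,\beta,T_0,\rho$) and the fixed data $f,g$, but not on $\varepsilon$, $T$ or $u$, such that if $u$ is a weak solution on $[0,T)$ with $T<\infty$, then either $1+B(T)\le R_0$, or $$\int_{R_0}^{1+B(T)}R^{-1+(p-1)\theta}\exp\bigl(-(p-1)\Omega_{\beta,T_0}(\log R)\bigr)\,dR\le C(\varepsilon\mathcal J_0)^{-(p-1)}.$$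
   Context: Effective damping: $b\in C^2([0,\infty))$ is positive and monotone; there is $C>0$ with $|b^{(k)}(t)|\le C b(t)(1+t)^{-k}$ for $k=1,2$ and all $t\ge0$; $tb(t)\to\infty$ as $t\to\infty$; $\frac{1}{b(t)(1+t)^2}\in L^1(0,\infty)$; and $tb'(t)\le a_0 b(t)$ for all $t\ge0$ for some $a_0\in[0,1)$. Dominated mass: $m\in C^2([0,\infty))$ is positive; there is $C>0$ with $|m^{(k)}(t)|\le C m(t)(1+t)^{-k}$ for $k=1,2$ and all $t\ge0$; and $m(t)=o(b(t))$ as $t\to\infty$. Notation: for $t\ge r\ge0$, $$B(t):=\int_0^t\frac{d\tau}{b(\tau)},\quad Q(t,r):=\int_r^t\frac{m^2(\tau)}{b(\tau)}\,d\tau,\quad X(t,r):=\frac{1+B(t)}{1+B(r)}\ge1.$$ Also $[s]_+:=\max\{s,0\}$. The lower mass index is $\beta:=\liminf_{t\to\infty}B(t)m^2(t)$. Intrinsic accumulated-mass balance: $\beta\in[0,\infty)$ is finite and there exists $T_0\ge0$ such that for every $L\ge0$ $$\Omega_{\beta,T_0}(L):=\sup_{t\ge r\ge T_0,\ \log X(t,r)\le L}\bigl[Q(t,r)-\beta\log X(t,r)\bigr]_+<\infty.$$ Global Liouville nonoscillation condition: $m^2(t)\le\frac{b^2(t)}4+\frac{b'(t)}2$ for every $t\ge0$. Positive slow adjoint solution: under the four conditions above there exists (by a separate theorem, which may be taken as given) a solution $\rho\in C^2([0,\infty))$ of $\rho''-(b\rho)'+m^2\rho=0$ such that, for some $C>0$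 and all $t\ge0$: $\rho(t)>0$; $b(t)\rho(t)-\rho'(t)>0$; $|\rho'(t)|\le Cb(t)\rho(t)$; $b(t)\rho(t)\le C(1+B(t))^\beta\exp(\Omega_{\beta,T_0}(\log(1+B(t))))$; and for some $T_*\ge T_0$ and all $t\ge T_*$: $C^{-1}b(t)^{-1}e^{Q(t,T_* )}\le\rho(t)\le C\,b(t)^{-1}e^{Q(t,T_* )}$ and $|\rho'(t)|\le\frac14 b(t)\rho(t)$. The symbol $\rho$ denotes such a fixed solution. Weak solution: let $T\in(0,\infty]$ and $f,g\in L^1(\mathbb R^n)$. A function $u\in L^p_{\mathrm{loc}}([0,T)\times\mathbb R^n)$ is a weak solution of the Cauchy problem on $[0,T)$ if for every $\phi\in C_c^2([0,T)\times\mathbb R^n)$ (support compact in $[0,T)\times\mathbb R^n$; $\phi$ need not vanish at $t=0$) $$\int_0^T\!\!\int_{\mathbb R^n}|u|^p\phi\,dx\,dt+\varepsilon\int_{\mathbb R^n}\bigl(g\phi(0)+b(0)f\phi(0)-f\phi_t(0)\bigr)dx=\int_0^T\!\!\int_{\mathbb R^n}u\bigl(\phi_{tt}-\Delta\phi-\partial_t(b\phi)+m^2\phi\bigr)dx\,dt.$$ *)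

theory Defs
  imports "HOL-Analysis.Analysis" "HOL-Library.Landau_Symbols"
begin

section \<open>Functions on the half line\<close>

text \<open>Functions on \<open>[0,\<infinity>)\<close> are total functions on the reals whose values at negative arguments
  play no role. Hence derivatives are taken within \<open>[0,\<infinity>)\<close>: one-sided at \<open>0\<close>,
  two-sided elsewhere.\<close>

definition hderiv :: "(real \<Rightarrow> real) \<Rightarrow> real \<Rightarrow> real" where
  "hderiv f t = vector_derivative f (at t within {0..})"

definition C2_halfline :: "(real \<Rightarrow> real) \<Rightarrow> bool" where
  "C2_halfline f \<longleftrightarrow>
     f differentiable_on {0..} \<and> hderiv f differentiable_on {0..} \<and>
     continuous_on {0..} (hderiv (hderiv f))"

definition symbol_bounds :: "(real \<Rightarrow> real) \<Rightarrow> bool" where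
  "symbol_bounds f \<longleftrightarrow>
     (\<exists>C>0. \<forall>t\<ge>0. \<bar>hderiv f t\<bar> \<le> C * f t / (1 + t) \<and>
                    \<bar>hderiv (hderiv f) t\<bar> \<le> C * f t / (1 + t)\<^sup>2)"

definition effective_damping :: "(real \<Rightarrow> real) \<Rightarrow> bool" where
  "effective_damping b \<longleftrightarrow>
     C2_halfline b \<and> (\<forall>t\<ge>0. b t > 0) \<and>
     (mono_on {0..} b \<or> antimono_on {0..} b) \<and>
     symbol_bounds b \<and>
     filterlim (\<lambda>t. t * b t) at_top at_top \<and>
     set_integrable lebesgue {0<..} (\<lambda>t. 1 / (b t * (1 + t)\<^sup>2)) \<and>
     (\<exists>a\<^sub>0. 0 \<le> a\<^sub>0 \<and> a\<^sub>0 < 1 \<and> (\<forall>t\<ge>0. t * hderiv b t \<le> a\<^sub>0 * b t))"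

definition dominated_mass :: "(real \<Rightarrow> real) \<Rightarrow> (real \<Rightarrow> real) \<Rightarrow> bool" where
  "dominated_mass b m \<longleftrightarrow>
     C2_halfline m \<and> (\<forall>t\<ge>0. m t > 0) \<and> symbol_bounds m \<and> m \<in> o[at_top](b)"

definition Bfun :: "(real \<Rightarrow> real) \<Rightarrow> real \<Rightarrow> real" where
  "Bfun b t = integral {0..t} (\<lambda>\<tau>. 1 / b \<tau>)"

definition Qfun :: "(real \<Rightarrow> real) \<Rightarrow> (real \<Rightarrow> real) \<Rightarrow> real \<Rightarrow> real \<Rightarrow> real" where
  "Qfun b m t r = integral {r..t} (\<lambda>\<tau>. (m \<tau>)\<^sup>2 / b \<tau>)"

definition Xfun :: "(real \<Rightarrow> real) \<Rightarrow> real \<Rightarrow> real \<Rightarrow> real" where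
  "Xfun b t r = (1 + Bfun b t) / (1 + Bfun b r)"

definition lower_mass_index :: "(real \<Rightarrow> real) \<Rightarrow> (real \<Rightarrow> real) \<Rightarrow> ereal" where
  "lower_mass_index b m = Liminf at_top (\<lambda>t. ereal (Bfun b t * (m t)\<^sup>2))"

definition mass_excess_set ::
    "(real \<Rightarrow> real) \<Rightarrow> (real \<Rightarrow> real) \<Rightarrow> real \<Rightarrow> real \<Rightarrow> real \<Rightarrow> real set" where
  "mass_excess_set b m \<beta> T\<^sub>0 L =
     {max (Qfun b m t r - \<beta> * ln (Xfun b t r)) 0 | t r.
        T\<^sub>0 \<le> r \<and> r \<le> t \<and> ln (Xfun b t r) \<le> L}"

text \<open>A real supremum, hence meaningful only where \<^const>\<open>mass_excess_set\<close> is bounded above;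
  this is part of \<open>mass_balance\<close> below.\<close>

definition Omega ::
    "(real \<Rightarrow> real) \<Rightarrow> (real \<Rightarrow> real) \<Rightarrow> real \<Rightarrow> real \<Rightarrow> real \<Rightarrow> real" where
  "Omega b m \<beta> T\<^sub>0 L = Sup (mass_excess_set b m \<beta> T\<^sub>0 L)"

definition mass_balance ::
    "(real \<Rightarrow> real) \<Rightarrow> (real \<Rightarrow> real) \<Rightarrow> real \<Rightarrow> real \<Rightarrow> bool" where
  "mass_balance b m \<beta> T\<^sub>0 \<longleftrightarrow>
     lower_mass_index b m = ereal \<beta> \<and> \<beta> \<ge> 0 \<and> T\<^sub>0 \<ge> 0 \<and>
     (\<forall>L\<ge>0. bdd_above (mass_excess_set b m \<beta> T\<^sub>0 L))"

definition nonoscillation :: "(real \<Rightarrow> real) \<Rightarrow> (real \<Rightarrow> real) \<Rightarrow> bool" where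
  "nonoscillation b m \<longleftrightarrow> (\<forall>t\<ge>0. (m t)\<^sup>2 \<le> (b t)\<^sup>2 / 4 + hderiv b t / 2)"

definition slow_adjoint_solution ::
    "(real \<Rightarrow> real) \<Rightarrow> (real \<Rightarrow> real) \<Rightarrow> real \<Rightarrow> real \<Rightarrow> (real \<Rightarrow> real) \<Rightarrow> bool" where
  "slow_adjoint_solution b m \<beta> T\<^sub>0 \<rho> \<longleftrightarrow>
     C2_halfline \<rho> \<and>
     (\<forall>t\<ge>0. hderiv (hderiv \<rho>) t - hderiv (\<lambda>s. b s * \<rho> s) t + (m t)\<^sup>2 * \<rho> t = 0) \<and>
     (\<exists>C>0.
        (\<forall>t\<ge>0. \<rho> t > 0 \<and> b t * \<rho> t - hderiv \<rho> t > 0 \<and>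
                 \<bar>hderiv \<rho> t\<bar> \<le> C * b t * \<rho> t \<and>
                 b t * \<rho> t \<le> C * (1 + Bfun b t) powr \<beta> *
                              exp (Omega b m \<beta> T\<^sub>0 (ln (1 + Bfun b t)))) \<and>
        (\<exists>T\<^sub>s\<ge>T\<^sub>0. \<forall>t\<ge>T\<^sub>s.
                 exp (Qfun b m t T\<^sub>s) / (C * b t) \<le> \<rho> t \<and>
                 \<rho> t \<le> C * exp (Qfun b m t T\<^sub>s) / b t \<and>
                 \<bar>hderiv \<rho> t\<bar> \<le> b t * \<rho> t / 4))"

definition lifespan_weight ::
    "(real \<Rightarrow> real) \<Rightarrow> (real \<Rightarrow> real) \<Rightarrow> real \<Rightarrow> real \<Rightarrow> real \<Rightarrow> real \<Rightarrow> real \<Rightarrow> real" where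
  "lifespan_weight b m \<beta> T\<^sub>0 p \<theta> R =
     R powr (-1 + (p - 1) * \<theta>) * exp (- (p - 1) * Omega b m \<beta> T\<^sub>0 (ln R))"

section \<open>Weak solutions\<close>

definition cyl :: "ereal \<Rightarrow> (real \<times> (real ^ 'n::finite)) set" where
  "cyl T = {z. 0 \<le> fst z \<and> ereal (fst z) < T}"

text \<open>Frechet derivatives within \<open>S\<close>; on \<^const>\<open>cyl\<close> this is regularity up to and including
  the time slice \<open>t = 0\<close>.\<close>

definition C2_on :: "'a::real_normed_vector set \<Rightarrow> ('a \<Rightarrow> real) \<Rightarrow> bool" where
  "C2_on S f \<longleftrightarrow>
     (\<exists>(D :: 'a \<Rightarrow> 'a \<Rightarrow>\<^sub>L real) (D2 :: 'a \<Rightarrow> 'a \<Rightarrow>\<^sub>L 'a \<Rightarrow>\<^sub>L real).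
        (\<forall>z\<in>S. (f has_derivative blinfun_apply (D z)) (at z within S)) \<and>
        (\<forall>z\<in>S. (D has_derivative blinfun_apply (D2 z)) (at z within S)) \<and>
        continuous_on S D2)"

definition test_function :: "ereal \<Rightarrow> (real \<times> (real ^ 'n::finite) \<Rightarrow> real) \<Rightarrow> bool" where
  "test_function T \<phi> \<longleftrightarrow>
     C2_on (cyl T) \<phi> \<and>
     compact (closure {z \<in> cyl T. \<phi> z \<noteq> 0}) \<and> closure {z \<in> cyl T. \<phi> z \<noteq> 0} \<subseteq> cyl T"

definition dt :: "(real \<times> (real ^ 'n::finite) \<Rightarrow> real) \<Rightarrow> real \<times> (real ^ 'n) \<Rightarrow> real" where
  "dt \<phi> z = hderiv (\<lambda>s. \<phi> (s, snd z)) (fst z)"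

definition dx :: "'n::finite \<Rightarrow> (real \<times> (real ^ 'n) \<Rightarrow> real) \<Rightarrow> real \<times> (real ^ 'n) \<Rightarrow> real" where
  "dx i \<phi> z = deriv (\<lambda>s. \<phi> (fst z, snd z + s *\<^sub>R axis i 1)) 0"

definition laplacian :: "(real \<times> (real ^ 'n::finite) \<Rightarrow> real) \<Rightarrow> real \<times> (real ^ 'n) \<Rightarrow> real" where
  "laplacian \<phi> z = (\<Sum>i\<in>UNIV. dx i (dx i \<phi>) z)"

definition Lp_loc :: "real \<Rightarrow> 'a::euclidean_space set \<Rightarrow> ('a \<Rightarrow> real) \<Rightarrow> bool" where
  "Lp_loc p S u \<longleftrightarrow>
     set_borel_measurable lebesgue S u \<and>
     (\<forall>K. compact K \<and> K \<subseteq> S \<longrightarrow> set_integrable lebesgue K (\<lambda>z. \<bar>u z\<bar> powr p))"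

definition weak_solution ::
    "(real \<Rightarrow> real) \<Rightarrow> (real \<Rightarrow> real) \<Rightarrow> real \<Rightarrow> real \<Rightarrow> (real ^ 'n::finite \<Rightarrow> real) \<Rightarrow>
     (real ^ 'n \<Rightarrow> real) \<Rightarrow> ereal \<Rightarrow> (real \<times> (real ^ 'n) \<Rightarrow> real) \<Rightarrow> bool" where
  "weak_solution b m p \<epsilon> f g T u \<longleftrightarrow>
     Lp_loc p (cyl T) u \<and>
     (\<forall>\<phi>. test_function T \<phi> \<longrightarrow>
        (LINT z:cyl T|lebesgue. \<bar>u z\<bar> powr p * \<phi> z)
        + \<epsilon> * (LINT x|lebesgue. g x * \<phi> (0, x) + b 0 * f x * \<phi> (0, x) - f x * dt \<phi> (0, x))
        = (LINT z:cyl T|lebesgue. u z *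
             (dt (dt \<phi>) z - laplacian \<phi> z - dt (\<lambda>y. b (fst y) * \<phi> y) z
              + (m (fst z))\<^sup>2 * \<phi> z)))"

end

theory Submission
  imports Defs
begin

text \<open>
  Test the equation with \<open>\<phi> = \<rho>(t) \<psi>(h/R)\<close>, where \<open>h = 1 + B(t) + \<bar>x\<bar>\<^sup>2\<close> is the parabolic
  variable and \<open>\<psi>\<close> a cutoff. As \<open>\<rho>\<close> solves the adjoint equation, only derivatives of \<open>\<psi>\<close>
  survive, and the adjoint operator maps \<open>\<phi>\<close> to something of size
  \<open>(\<rho>/R) (-\<psi>'(h/R))\<^bsup>1/p\<^esup>\<close>, provided that \<open>-\<psi>'\<close> vanishes to high order. With
  \<open>F(R) = \<integral>\<integral> \<bar>u\<bar>\<^sup>p \<rho> \<psi>(h/R) + \<epsilon>J\<^sub>0/2\<close> one has \<open>R F'(R) \<ge> (1/2) \<integral>\<integral> \<bar>u\<bar>\<^sup>p \<rho> (-\<psi>'(h/R))\<close>,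
  so Hoelder's inequality and the bound for the \<open>\<rho>\<close>-mass of \<open>{h \<le> R}\<close> give
  \<open>w F\<^sup>p \<le> C F'\<close>, where \<open>w\<close> is the lifespan weight. Integrating \<open>w \<le> C F' F\<^bsup>-p\<^esup>\<close> gives
  the lifespan bound.
\<close>

section \<open>Calculus on sets and cutoff functions\<close>

text \<open>The exponent in the weight is a scaling count. Hoelder's inequality multiplies R^(-p) by
  the power p - 1 of the \<rho>-mass of {h \<le> R}, which is of order R^(n/2 + \<beta> + 1)
  exp(\<Omega>(ln R)); \<theta> is the number for which this product becomes 1 / (R w(R)). Two
  obstacles shape the proof. A solution is only locally p-integrable up to T, and a test function
  must be supported before T. Hence a time \<tau> < T is fixed, the density |u|^p \<rho> is cut to
  the compact set {h \<le> 1 + B(\<tau>)}, and only radii R \<le> 1 + B(\<tau>) occur; the cut is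
  invisible to \<psi>(h/R), and since no constant depends on \<tau>, the radius 1 + B(T) is reached
  by continuity of the measure from below. The other obstacle is that the space-time integral in F
  may vanish, while F^(1-p) has to be bounded at the left end point. The data term tends to J_0 as R
  grows, so beyond a radius R_0 it exceeds \<epsilon> J_0 / 2; keeping this constant inside F
  supplies both positivity and the dependence of the bound on \<epsilon> J_0.\<close>

definition C1_on :: "'a::real_normed_vector set \<Rightarrow> ('a \<Rightarrow> 'b::real_normed_vector) \<Rightarrow> bool" where
  "C1_on S F \<longleftrightarrow>
     (\<exists>D :: 'a \<Rightarrow> 'a \<Rightarrow>\<^sub>L 'b.
        (\<forall>z\<in>S. (F has_derivative blinfun_apply (D z)) (at z within S)) \<and> continuous_on S D)"

text \<open>Second order is reduced to first order for the \<open>blinfun\<close>-valued derivative,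
  which is why \<open>C1_on\<close> allows any normed codomain. Derivatives within \<open>S\<close>
  need not be unique; each closure rule below exhibits one continuous choice.\<close>

lemma C2_on_iff_C1_on:
  "C2_on S f \<longleftrightarrow>
     (\<exists>D. (\<forall>z\<in>S. (f has_derivative blinfun_apply (D z)) (at z within S)) \<and> C1_on S D)"
  by (auto simp: C2_on_def C1_on_def)

lemma C1_on_imp_continuous_on:
  assumes "C1_on S F"
  shows "continuous_on S F"
proof -
  obtain D where "\<And>z. z \<in> S \<Longrightarrow> (F has_derivative blinfun_apply (D z)) (at z within S)"
    using assms by (auto simp: C1_on_def)
  then show ?thesis by (rule has_derivative_continuous_on)
qed

lemma C2_on_imp_C1_on:
  assumes "C2_on S f"
  shows "C1_on S f"
proof -
  obtain D where D: "\<And>z. z \<in> S \<Longrightarrow> (f has_derivative blinfun_apply (D z)) (at z within S)"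
    "C1_on S D" using assms by (auto simp: C2_on_iff_C1_on)
  show ?thesis
    unfolding C1_on_def by (intro exI[of _ D] conjI ballI D C1_on_imp_continuous_on)
qed

lemma C1_on_const: "C1_on S (\<lambda>z. c)"
  unfolding C1_on_def
  by (intro exI[of _ "\<lambda>z. 0"] conjI ballI continuous_on_const)
    (simp add: zero_blinfun.rep_eq)

lemma C1_on_add:
  assumes "C1_on S F" "C1_on S G"
  shows "C1_on S (\<lambda>z. F z + G z)"
proof -
  obtain D where D: "\<And>z. z \<in> S \<Longrightarrow> (F has_derivative blinfun_apply (D z)) (at z within S)"
    "continuous_on S D" using assms(1) by (auto simp: C1_on_def)
  obtain E where E: "\<And>z. z \<in> S \<Longrightarrow> (G has_derivative blinfun_apply (E z)) (at z within S)"
    "continuous_on S E" using assms(2) by (auto simp: C1_on_def)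
  show ?thesis unfolding C1_on_def
    by (intro exI[of _ "\<lambda>z. D z + E z"] conjI ballI continuous_on_add D(2) E(2))
      (simp add: plus_blinfun.rep_eq has_derivative_add D(1) E(1))
qed

text \<open>Derivatives of products and of compositions are real factors times maps into a space of
  linear functionals, so this is the product rule that \<open>C2_on_mult\<close> and
  \<open>C2_on_compose\<close> call for.\<close>

lemma C1_on_scaleR:
  fixes s :: "'a::real_normed_vector \<Rightarrow> real"
  assumes "C1_on S s" "C1_on S F"
  shows "C1_on S (\<lambda>z. s z *\<^sub>R F z)"
proof -
  obtain D where D: "\<And>z. z \<in> S \<Longrightarrow> (s has_derivative blinfun_apply (D z)) (at z within S)"
    "continuous_on S D" using assms(1) by (auto simp: C1_on_def)
  obtain E where E: "\<And>z. z \<in> S \<Longrightarrow> (F has_derivative blinfun_apply (E z)) (at z within S)"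
    "continuous_on S E" using assms(2) by (auto simp: C1_on_def)
  have c: "continuous_on S s" "continuous_on S F"
    using assms by (auto intro: C1_on_imp_continuous_on)
  let ?G = "\<lambda>z. s z *\<^sub>R E z + (blinfun_scaleR_left (F z) o\<^sub>L D z)"
  have "((\<lambda>z. s z *\<^sub>R F z) has_derivative blinfun_apply (?G z)) (at z within S)" if "z \<in> S" for z
    using has_derivative_scaleR[OF D(1)[OF that] E(1)[OF that]]
    by (simp add: plus_blinfun.rep_eq scaleR_blinfun.rep_eq blinfun_compose.rep_eq o_def)
  moreover have "continuous_on S ?G"
    by (intro continuous_intros c D E
        bounded_linear.continuous_on[OF bounded_linear_blinfun_scaleR_left] 
        bounded_bilinear.continuous_on[OF bounded_bilinear_blinfun_compose])
  ultimately show ?thesis unfolding C1_on_def by (intro exI[of _ ?G] conjI ballI)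
qed

text \<open>The outer function is differentiated within a set \<open>A\<close> because the
  coefficients are differentiable only on the half line. Restricting its derivative to the image of
  \<open>S\<close> makes the chain rule within \<open>S\<close> applicable.\<close>

lemma C1_on_compose:
  fixes s :: "'a::real_normed_vector \<Rightarrow> real" and h h' :: "real \<Rightarrow> real"
  assumes s: "C1_on S s" "s ` S \<subseteq> A"
    and h: "\<And>x. x \<in> A \<Longrightarrow> (h has_real_derivative h' x) (at x within A)" "continuous_on A h'"
  shows "C1_on S (\<lambda>z. h (s z))"
proof -
  obtain D where D: "\<And>z. z \<in> S \<Longrightarrow> (s has_derivative blinfun_apply (D z)) (at z within S)"
    "continuous_on S D" using s(1) by (auto simp: C1_on_def)
  let ?G = "\<lambda>z. h' (s z) *\<^sub>R D z"
  have "((\<lambda>z. h (s z)) has_derivative blinfun_apply (?G z)) (at z within S)" if "z \<in> S" for z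
  proof -
    have "(h has_derivative (*) (h' (s z))) (at (s z) within s ` S)"
      by (rule has_derivative_subset[OF h(1)[unfolded has_field_derivative_def] s(2)])
        (use that s in auto)
    from has_derivative_in_compose[OF D(1)[OF that] this] show ?thesis
      by (simp add: scaleR_blinfun.rep_eq)
  qed
  moreover have "continuous_on S ?G"
    by (intro continuous_intros D continuous_on_compose2[OF h(2) C1_on_imp_continuous_on[OF s(1)] s(2)])
  ultimately show ?thesis unfolding C1_on_def by (intro exI[of _ ?G] conjI ballI)
qed

lemma C2_on_linear: "bounded_linear f \<Longrightarrow> C2_on S f"
  unfolding C2_on_iff_C1_on
  by (intro exI[of _ "\<lambda>z. Blinfun f"] conjI ballI C1_on_const)
    (simp add: bounded_linear_Blinfun_apply bounded_linear_imp_has_derivative)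

lemma C2_on_const: "C2_on S (\<lambda>z. c)"
  unfolding C2_on_iff_C1_on
  by (intro exI[of _ "\<lambda>z. 0"] conjI ballI C1_on_const) (simp add: zero_blinfun.rep_eq)

lemma C2_on_add:
  assumes "C2_on S f" "C2_on S g"
  shows "C2_on S (\<lambda>z. f z + g z)"
proof -
  obtain D where D: "\<And>z. z \<in> S \<Longrightarrow> (f has_derivative blinfun_apply (D z)) (at z within S)"
    "C1_on S D" using assms(1) by (auto simp: C2_on_iff_C1_on)
  obtain E where E: "\<And>z. z \<in> S \<Longrightarrow> (g has_derivative blinfun_apply (E z)) (at z within S)"
    "C1_on S E" using assms(2) by (auto simp: C2_on_iff_C1_on)
  show ?thesis unfolding C2_on_iff_C1_on
    by (intro exI[of _ "\<lambda>z. D z + E z"] conjI ballI C1_on_add D(2) E(2))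
      (simp add: plus_blinfun.rep_eq has_derivative_add D(1) E(1))
qed

lemma C2_on_sum: "(\<And>i. i \<in> I \<Longrightarrow> C2_on S (f i)) \<Longrightarrow> C2_on S (\<lambda>z. \<Sum>i\<in>I. f i z)"
  by (induction I rule: infinite_finite_induct) (auto intro: C2_on_const C2_on_add)

lemma C2_on_mult:
  assumes "C2_on S f" "C2_on S g"
  shows "C2_on S (\<lambda>z. f z * g z)"
proof -
  obtain D where D: "\<And>z. z \<in> S \<Longrightarrow> (f has_derivative blinfun_apply (D z)) (at z within S)"
    "C1_on S D" using assms(1) by (auto simp: C2_on_iff_C1_on)
  obtain E where E: "\<And>z. z \<in> S \<Longrightarrow> (g has_derivative blinfun_apply (E z)) (at z within S)"
    "C1_on S E" using assms(2) by (auto simp: C2_on_iff_C1_on)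
  show ?thesis unfolding C2_on_iff_C1_on
  proof (intro exI[of _ "\<lambda>z. f z *\<^sub>R E z + g z *\<^sub>R D z"] conjI ballI)
    fix z assume "z \<in> S"
    from has_derivative_mult[OF D(1)[OF this] E(1)[OF this]]
    show "((\<lambda>z. f z * g z) has_derivative blinfun_apply (f z *\<^sub>R E z + g z *\<^sub>R D z)) (at z within S)"
      by (simp add: plus_blinfun.rep_eq scaleR_blinfun.rep_eq mult.commute)
  qed (intro C1_on_add C1_on_scaleR C2_on_imp_C1_on assms D E)
qed

lemma C2_on_compose:
  fixes s :: "'a::real_normed_vector \<Rightarrow> real" and h h' h'' :: "real \<Rightarrow> real"
  assumes s: "C2_on S s" "s ` S \<subseteq> A"
    and h: "\<And>x. x \<in> A \<Longrightarrow> (h has_real_derivative h' x) (at x within A)"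
      "\<And>x. x \<in> A \<Longrightarrow> (h' has_real_derivative h'' x) (at x within A)" "continuous_on A h''"
  shows "C2_on S (\<lambda>z. h (s z))"
proof -
  obtain D where D: "\<And>z. z \<in> S \<Longrightarrow> (s has_derivative blinfun_apply (D z)) (at z within S)"
    "C1_on S D" using s(1) by (auto simp: C2_on_iff_C1_on)
  show ?thesis unfolding C2_on_iff_C1_on
  proof (intro exI[of _ "\<lambda>z. h' (s z) *\<^sub>R D z"] conjI ballI)
    fix z assume z: "z \<in> S"
    have "(h has_derivative (*) (h' (s z))) (at (s z) within s ` S)"
      by (rule has_derivative_subset[OF h(1)[unfolded has_field_derivative_def] s(2)])
        (use z s in auto)
    from has_derivative_in_compose[OF D(1)[OF z] this]
    show "((\<lambda>z. h (s z)) has_derivative blinfun_apply (h' (s z) *\<^sub>R D z)) (at z within S)"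
      by (simp add: scaleR_blinfun.rep_eq)
  qed (intro C1_on_scaleR D C1_on_compose[OF C2_on_imp_C1_on[OF s(1)] s(2) h(2,3)])
qed

section \<open>Construction of the cutoff\<close>

text \<open>The only delicate point is the kink at 0: there the difference quotient is again a
  truncated power, and the exponent \<open>k + 1\<close> that remains is positive.\<close>

lemma has_real_derivative_max0_power:
  "((\<lambda>x::real. max 0 x ^ (k + 2)) has_real_derivative real (k + 2) * max 0 x ^ (k + 1)) (at x)"
proof -
  consider "x < 0" | "x > 0" | "x = 0" by linarith
  then show ?thesis
  proof cases
    case 1
    have "((\<lambda>x::real. 0) has_real_derivative 0) (at x)" by simp
    then have "((\<lambda>x::real. max 0 x ^ (k + 2)) has_real_derivative 0) (at x)"
      by (rule has_field_derivative_transform_within_open[where S = "{..<0}"]) (use 1 in auto)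
    then show ?thesis using 1 by simp
  next
    case 2
    have "((\<lambda>x::real. x ^ (k + 2)) has_real_derivative real (k + 2) * x ^ (k + 1)) (at x)"
      using DERIV_pow[of "k + 2" x] by simp
    then have "((\<lambda>x::real. max 0 x ^ (k + 2)) has_real_derivative real (k + 2) * x ^ (k + 1)) (at x)"
      by (rule has_field_derivative_transform_within_open[where S = "{0<..}"]) (use 2 in auto)
    then show ?thesis using 2 by simp
  next
    case 3
    have "((\<lambda>y::real. max 0 y ^ (k + 1)) \<longlongrightarrow> max 0 0 ^ (k + 1)) (at 0)"
      by (intro tendsto_intros)
    then have "((\<lambda>y::real. max 0 y ^ (k + 1)) \<longlongrightarrow> 0) (at 0)" by simp
    then have "((\<lambda>y::real. max 0 y ^ (k + 2) / y) \<longlongrightarrow> 0) (at 0)"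
      by (rule Lim_transform_eventually) (auto simp: eventually_at_filter max_def)
    then show ?thesis using 3 by (simp add: has_field_derivative_iff)
  qed
qed

text \<open>The derivative is chosen before the function: \<open>- \<psi>'\<close> is a normalised
  power of a bump \<open>w\<close>, and \<open>\<psi>\<close> is recovered from a primitive. The two
  domination estimates thereby become comparisons between powers of \<open>w\<close>.\<close>

lemma cutoff_exists:
  fixes p :: real
  assumes p: "p > 1"
  obtains \<psi> \<psi>' \<psi>'' :: "real \<Rightarrow> real" and K :: real where
    "\<And>s. (\<psi> has_real_derivative \<psi>' s) (at s)" "\<And>s. (\<psi>' has_real_derivative \<psi>'' s) (at s)"
    "continuous_on UNIV \<psi>''"
    "\<And>s. s \<le> 1 / 2 \<Longrightarrow> \<psi> s = 1" "\<And>s. s \<ge> 1 \<Longrightarrow> \<psi> s = 0"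
    "\<And>s. s \<le> 1 / 2 \<or> s \<ge> 1 \<Longrightarrow> \<psi>' s = 0" "\<And>s. s \<le> 1 / 2 \<or> s \<ge> 1 \<Longrightarrow> \<psi>'' s = 0"
    "\<And>s. \<psi>' s \<le> 0" "K > 0"
    "\<And>s. \<bar>\<psi>' s\<bar> \<le> K * (- \<psi>' s) powr (1 / p)" "\<And>s. \<bar>\<psi>'' s\<bar> \<le> K * (- \<psi>' s) powr (1 / p)"
proof -
  \<comment> \<open>\<open>-\<psi>'\<close> is a multiple of \<open>w\<^bsup>k+2\<^esup>\<close> and \<open>\<psi>''\<close> is of size \<open>w\<^bsup>k+1\<^esup>\<close>, so \<open>(k+2)/p \<le> k+1\<close> is what is needed.\<close>
  obtain k :: nat where k: "real k > p / (p - 1)" using reals_Archimedean2 by blast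
  have k': "real (k + 2) / p \<le> real (k + 1)"
  proof -
    have "k * (p - 1) \<ge> p" using k p by (simp add: field_simps)
    then have "real (k + 2) \<le> real (k + 1) * p" using p by (simp add: algebra_simps)
    then show ?thesis using p by (simp add: field_simps)
  qed
  \<comment> \<open>Positive exactly on (1/2, 1). Its values are at most 1, so a smaller exponent
    gives a larger power.\<close>
  define w where "w s = max 0 ((s - 1 / 2) * (1 - s))" for s :: real
  define q where "q s = w s ^ (k + 2)" for s
  define q' where "q' s = real (k + 2) * w s ^ (k + 1) * (3 / 2 - 2 * s)" for s
  have w0: "w s \<ge> 0" for s by (simp add: w_def)
  have w1: "w s \<le> 1" for s
  proof -
    have "(s - 1 / 2) * (1 - s) = 1 / 16 - (s - 3 / 4)\<^sup>2"
      by (simp add: power2_eq_square field_simps)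
    then have "(s - 1 / 2) * (1 - s) \<le> 1 / 16" by simp
    then show ?thesis by (simp add: w_def)
  qed
  have wz: "w s = 0" if "s \<le> 1 / 2 \<or> s \<ge> 1" for s
  proof -
    have "(s - 1 / 2) * (1 - s) \<le> 0"
      using that by (auto intro: mult_nonneg_nonpos mult_nonpos_nonneg)
    then show ?thesis by (simp add: w_def)
  qed
  have wpos: "w s > 0" if "1 / 2 < s" "s < 1" for s
    using that by (simp add: w_def less_max_iff_disj)
  have dq: "(q has_real_derivative q' s) (at s)" for s
  proof -
    have "((\<lambda>s. (s - 1 / 2) * (1 - s)) has_real_derivative 3 / 2 - 2 * s) (at s)"
      by (rule DERIV_cong[where X = "(1 - 0) * (1 - s) + (0 - 1) * (s - 1 / 2)"])
        (intro derivative_intros | simp)+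
    from DERIV_chain2[OF has_real_derivative_max0_power this, of k] show ?thesis
      unfolding q_def q'_def w_def .
  qed
  have cq': "continuous_on UNIV q'" unfolding q'_def w_def by (intro continuous_intros)
  have cq: "isCont q s" for s using dq by (rule DERIV_isCont)
  have q0: "q s \<ge> 0" for s by (simp add: q_def w0)
  \<comment> \<open>Infinite end points yield a single primitive of \<open>q\<close> on the whole
    line.\<close>
  have "\<exists>F. \<forall>x::real. - \<infinity> < ereal x \<longrightarrow> ereal x < \<infinity> \<longrightarrow> (F has_vector_derivative q x) (at x)"
    by (rule einterval_antiderivative) (use cq in auto)
  then obtain F where F: "(F has_real_derivative q x) (at x)" for x
    by (auto simp: has_real_derivative_iff_has_vector_derivative)
  have Fle: "F x \<le> F y" if "x \<le> y" for x y
    using DERIV_nonneg_imp_nondecreasing[OF that] F q0 by blast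
  have Fr: "F s = F 1" if "s \<ge> 1" for s
  proof (cases "s = 1")
    case False
    with that have "1 < s" by simp
    moreover have "continuous_on {1..s} F"
      using F by (meson DERIV_isCont continuous_at_imp_continuous_on)
    moreover have "(F has_real_derivative 0) (at x)" if "1 < x" "x < s" for x
      using F[of x] wz[of x] that by (simp add: q_def)
    ultimately show ?thesis by (intro DERIV_isconst_end)
  qed simp
  have Fl: "F s = F (1 / 2)" if "s \<le> 1 / 2" for s
  proof (cases "s = 1 / 2")
    case False
    with that have "s < 1 / 2" by simp
    moreover have "continuous_on {s..1 / 2} F"
      using F by (meson DERIV_isCont continuous_at_imp_continuous_on)
    moreover have "(F has_real_derivative 0) (at x)" if "s < x" "x < 1 / 2" for x
      using F[of x] wz[of x] that by (simp add: q_def)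
    ultimately show ?thesis by (intro DERIV_isconst_end[symmetric])
  qed (simp only:)
  have "F (1 / 2) < F 1"
  proof (rule DERIV_pos_imp_increasing_open[of "1 / 2" 1 F])
    fix x :: real assume "1 / 2 < x" "x < 1"
    then show "\<exists>y. (F has_real_derivative y) (at x) \<and> 0 < y"
      using F[of x] wpos[of x] by (intro exI[of _ "q x"]) (simp add: q_def)
  next
    show "continuous_on {1 / 2..1} F"
      using F by (meson DERIV_isCont continuous_at_imp_continuous_on)
  qed simp
  \<comment> \<open>The total mass of the bump \<open>q\<close>; dividing by it makes
    \<open>\<psi>\<close> fall from 1 to exactly 0.\<close>
  define c where "c = F 1 - F (1 / 2)"
  have c: "c > 0" using \<open>F (1 / 2) < F 1\<close> by (simp add: c_def)
  define N where "N = real (k + 2)"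
  have N: "N \<ge> 2" by (simp add: N_def)
  have key: "w s ^ (k + 1) \<le> q s powr (1 / p)" for s
  proof (cases "w s = 0")
    case False
    then have ws: "w s > 0" using w0[of s] by simp
    have "w s ^ (k + 1) = w s powr real (k + 1)" using ws by (rule powr_realpow[symmetric])
    also have "\<dots> \<le> w s powr (real (k + 2) / p)"
      using ws w1 k' by (intro powr_mono') auto
    also have "\<dots> = (w s powr real (k + 2)) powr (1 / p)" by (simp add: powr_powr)
    also have "w s powr real (k + 2) = q s" unfolding q_def using ws by (rule powr_realpow)
    finally show ?thesis .
  qed simp
  have qw: "q s \<le> w s ^ (k + 1)" for s
    unfolding q_def using w0 w1 by (intro power_decreasing) auto
  \<comment> \<open>Both \<open>q\<close> and \<open>q'\<close> are at most
    \<open>N * q powr (1 / p)\<close> in absolute value; the factor \<open>c powr (1 / p)\<close>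
    compensates for replacing \<open>q\<close> by \<open>q / c\<close> under the power.\<close>
  define K where "K = N / c * (c powr (1 / p))"
  have K: "K > 0" unfolding K_def using N c by simp
  have Keq: "K * (q s / c) powr (1 / p) = N / c * q s powr (1 / p)" for s
    unfolding K_def using c by (simp add: powr_divide q0)
  have q'z: "q' s = 0" if "s \<le> 1 / 2 \<or> s \<ge> 1" for s
    using wz[OF that] by (simp add: q'_def)
  have q'le: "\<bar>q' s\<bar> \<le> N * w s ^ (k + 1)" for s
  proof (cases "s \<le> 1 / 2 \<or> s \<ge> 1")
    case True
    then show ?thesis using wz[OF True] by (simp add: q'_def)
  next
    case False
    then have "\<bar>3 / 2 - 2 * s\<bar> \<le> 1" by auto
    then have "N * w s ^ (k + 1) * \<bar>3 / 2 - 2 * s\<bar> \<le> N * w s ^ (k + 1) * 1"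
      by (intro mult_left_mono) (use w0 N in auto)
    then show ?thesis using w0[of s] N by (simp add: q'_def abs_mult N_def)
  qed
  show ?thesis
  proof (rule that[of "\<lambda>s. (F 1 - F s) / c" "\<lambda>s. - q s / c" "\<lambda>s. - q' s / c" K])
    show "((\<lambda>s. (F 1 - F s) / c) has_real_derivative - q s / c) (at s)" for s
      using DERIV_cdivide[OF DERIV_diff[OF DERIV_const F]] by simp
    show "((\<lambda>s. - q s / c) has_real_derivative - q' s / c) (at s)" for s
      by (rule DERIV_cdivide[OF DERIV_minus[OF dq]])
    show "continuous_on UNIV (\<lambda>s. - q' s / c)" using c by (intro continuous_intros cq') auto
    show "(F 1 - F s) / c = 1" if "s \<le> 1 / 2" for s
      using Fl[OF that] c by (simp add: c_def)
    show "(F 1 - F s) / c = 0" if "s \<ge> 1" for s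
      using Fr[OF that] by simp
    show "- q s / c = 0" "- q' s / c = 0" if "s \<le> 1 / 2 \<or> s \<ge> 1" for s
      using wz[OF that] q'z[OF that] by (auto simp: q_def)
    show "- q s / c \<le> 0" for s using q0 c by simp
    have "\<bar>q s\<bar> \<le> N * q s powr (1 / p)" for s
    proof -
      have "q s \<le> 1 * q s powr (1 / p)" using qw key by (metis mult_1 order_trans)
      also have "\<dots> \<le> N * q s powr (1 / p)" using N by (intro mult_right_mono) auto
      finally show ?thesis using q0[of s] by simp
    qed
    then show "\<bar>- q s / c\<bar> \<le> K * (- (- q s / c)) powr (1 / p)" for s
      using Keq[of s] c by (simp add: divide_right_mono)
    have "\<bar>q' s\<bar> \<le> N * q s powr (1 / p)" for s
      using q'le[of s] mult_left_mono[OF key[of s], of N] N by linarith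
    then show "\<bar>- q' s / c\<bar> \<le> K * (- (- q s / c)) powr (1 / p)" for s
      using Keq[of s] c by (simp add: divide_right_mono)
  qed (rule K)
qed

section \<open>Differentiation under the integral and the integrated differential inequality\<close>

text \<open>On a convex set the mean value estimate transfers the bound \<open>w\<close> from the
  derivative to all difference quotients, which is the domination that dominated convergence needs
  along sequences.\<close>

lemma has_real_derivative_lebesgue_integral:
  fixes G G' :: "real \<Rightarrow> 'a \<Rightarrow> real"
  assumes U: "open U" "convex U" "r \<in> U"
    and int: "\<And>r. r \<in> U \<Longrightarrow> integrable M (G r)"
    and der: "\<And>r x. r \<in> U \<Longrightarrow> ((\<lambda>r. G r x) has_real_derivative G' r x) (at r)"
    and meas: "\<And>r. r \<in> U \<Longrightarrow> G' r \<in> borel_measurable M"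
    and bound: "\<And>r x. r \<in> U \<Longrightarrow> \<bar>G' r x\<bar> \<le> w x" and w: "integrable M w"
  shows "((\<lambda>r. \<integral>x. G r x \<partial>M) has_real_derivative (\<integral>x. G' r x \<partial>M)) (at r)"
proof -
  have "((\<lambda>y. ((\<integral>x. G y x \<partial>M) - (\<integral>x. G r x \<partial>M)) / (y - r)) \<longlongrightarrow> (\<integral>x. G' r x \<partial>M)) (at r within U)"
    unfolding tendsto_at_iff_sequentially comp_def
  proof (intro allI impI)
    fix X assume X: "\<forall>i. X i \<in> U - {r}" "X \<longlonglongrightarrow> r"
    have XU: "X i \<in> U" "X i \<noteq> r" for i using X by auto
    have m: "G r \<in> borel_measurable M" if "r \<in> U" for r
      using int[OF that] by (rule borel_measurable_integrable)
    have "(\<lambda>i. \<integral>x. (G (X i) x - G r x) / (X i - r) \<partial>M) \<longlonglongrightarrow> (\<integral>x. G' r x \<partial>M)"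
    proof (rule integral_dominated_convergence[where w = w])
      show "G' r \<in> borel_measurable M" by (rule meas) fact
      show "(\<lambda>x. (G (X i) x - G r x) / (X i - r)) \<in> borel_measurable M" for i
        by (intro borel_measurable_divide borel_measurable_diff borel_measurable_const m XU U)
      show "AE x in M. (\<lambda>i. (G (X i) x - G r x) / (X i - r)) \<longlonglongrightarrow> G' r x"
      proof (rule AE_I2)
        fix x
        have "((\<lambda>y. (G y x - G r x) / (y - r)) \<longlongrightarrow> G' r x) (at r within U)"
          using der[OF U(3), of x] unfolding has_field_derivative_iff at_within_open[OF U(3,1)] .
        then show "(\<lambda>i. (G (X i) x - G r x) / (X i - r)) \<longlonglongrightarrow> G' r x"
          using X unfolding tendsto_at_iff_sequentially comp_def by simp
      qed
      show "AE x in M. norm ((G (X i) x - G r x) / (X i - r)) \<le> w x" for i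
      proof (rule AE_I2)
        fix x
        have "norm (G (X i) x - G r x) \<le> w x * norm (X i - r)"
          by (rule field_differentiable_bound[OF U(2), where f' = "\<lambda>r. G' r x"])
            (simp_all add: XU U der bound has_field_derivative_at_within)
        then show "norm ((G (X i) x - G r x) / (X i - r)) \<le> w x"
          using XU(2)[of i] by (simp add: norm_divide pos_divide_le_eq)
      qed
    qed (rule w)
    then show "(\<lambda>i. ((\<integral>x. G (X i) x \<partial>M) - (\<integral>x. G r x \<partial>M)) / (X i - r)) \<longlonglongrightarrow> (\<integral>x. G' r x \<partial>M)"
      using int[OF XU(1)] int[OF U(3)] by simp
  qed
  then show ?thesis unfolding has_field_derivative_iff at_within_open[OF U(3,1)] .
qed

text \<open>\<open>F' * F powr (- p)\<close> is the derivative of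
  \<open>- F powr (1 - p) / (p - 1)\<close>, whose value at \<open>b\<close> has the favourable
  sign; hence only the left end point enters the bound. The nonnegative integral is monotone for
  arbitrary \<open>W\<close>, so measurability is checked only for the majorant
  \<open>g\<close>.\<close>

lemma nn_integral_le_powr_of_differential_inequality:
  fixes F F' W :: "real \<Rightarrow> real"
  assumes p: "p > 1" and A: "A \<ge> 0" and ab: "a \<le> b"
    and F: "\<And>x. a \<le> x \<Longrightarrow> x \<le> b \<Longrightarrow> (F has_real_derivative F' x) (at x)"
    and F': "continuous_on {a..b} F'" and pos: "\<And>x. a \<le> x \<Longrightarrow> x \<le> b \<Longrightarrow> F x > 0"
    and W: "\<And>x. a \<le> x \<Longrightarrow> x \<le> b \<Longrightarrow> 0 \<le> W x \<and> W x * F x powr p \<le> A * F' x"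
  shows "(\<integral>\<^sup>+x\<in>{a..b}. ennreal (W x) \<partial>lborel) \<le> ennreal (A / (p - 1) * F a powr (1 - p))"
proof -
  define g where "g x = A * F' x * F x powr (- p) * indicator {a..b} x" for x
  define G where "G x = - (A / (p - 1)) * F x powr (1 - p)" for x
  have Wg: "W x \<le> g x" if "a \<le> x" "x \<le> b" for x
    using W[OF that] pos[OF that] that by (simp add: g_def powr_minus divide_inverse[symmetric] pos_le_divide_eq)
  have cF: "continuous_on {a..b} F"
    using F by (intro DERIV_continuous_on) (auto intro: has_field_derivative_at_within)
  have "(\<integral>\<^sup>+x\<in>{a..b}. ennreal (W x) \<partial>lborel) \<le> (\<integral>\<^sup>+x\<in>{a..b}. ennreal (g x) \<partial>lborel)"
    by (intro nn_integral_mono) (auto simp: indicator_def intro!: ennreal_leI Wg)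
  also have "\<dots> = ennreal (G b - G a)"
  proof (rule nn_integral_FTC_Icc)
    have "continuous_on {a..b} (\<lambda>x. A * F' x * F x powr (- p))"
      by (intro continuous_intros F' cF) (use pos in fastforce)
    then have "(\<lambda>x. indicator {a..b} x *\<^sub>R (A * F' x * F x powr (- p))) \<in> borel_measurable borel"
      by (intro borel_measurable_continuous_on_indicator) auto
    then show "g \<in> borel_measurable borel" unfolding g_def by (simp add: mult.commute)
    fix x assume x: "x \<in> {a..b}"
    have "((\<lambda>x. - (A / (p - 1)) * F x powr (1 - p)) has_real_derivative
        - (A / (p - 1)) * ((1 - p) * F x powr (1 - p - 1) * F' x)) (at x)"
      using DERIV_cmult[OF DERIV_fun_powr[of F "F' x" x "1 - p"], of "- (A / (p - 1))"] x F pos by simp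
    moreover have "- (A / (p - 1)) * ((1 - p) * F x powr (1 - p - 1) * F' x) = g x"
      using x p by (simp add: g_def divide_simps) (simp add: algebra_simps)
    ultimately show "DERIV G x :> g x" unfolding G_def by simp
    show "0 \<le> g x" using Wg W x by (meson atLeastAtMost_iff order_trans)
  qed (use ab in auto)
  also have "\<dots> \<le> ennreal (A / (p - 1) * F a powr (1 - p))"
  proof (rule ennreal_leI)
    have "G b \<le> 0" using A p by (simp add: G_def)
    then show "G b - G a \<le> A / (p - 1) * F a powr (1 - p)" by (simp add: G_def)
  qed
  finally show ?thesis .
qed

section \<open>Effective damping\<close>

lemma at_within_halfline: "0 < t \<Longrightarrow> at t within {0..} = at (t::real)"
  by (rule at_within_interior) (simp add: interior_real_atLeast)

text \<open>Uniqueness of a derivative within the half line requires a nontrivial filter. This holds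
  even at 0, approached from the right, and it turns computed derivatives into values of
  \<open>hderiv\<close>.\<close>

lemma hderiv_eqI:
  assumes "(f has_real_derivative d) (at t within {0..})" "0 \<le> t"
  shows "hderiv f t = d"
proof -
  have "at t within {0..} \<noteq> bot"
  proof (cases "t = 0")
    case True
    then show ?thesis by (simp add: trivial_limit_at_right_real at_within_Ici_at_right)
  next
    case False
    then show ?thesis using assms(2) by (simp add: at_within_halfline)
  qed
  then show ?thesis
    unfolding hderiv_def using assms(1)
    by (intro vector_derivative_within) (simp_all add: has_real_derivative_iff_has_vector_derivative)
qed

lemma has_real_derivative_hderiv:
  assumes "f differentiable_on {0..}" "0 \<le> t"
  shows "(f has_real_derivative hderiv f t) (at t within {0..})"
  unfolding hderiv_def has_real_derivative_iff_has_vector_derivative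
  using assms by (auto simp: differentiable_on_def vector_derivative_works[symmetric])

text \<open>At the end point 0 the one-sided derivative contributes only continuity; the
  monotonicity argument uses interior points, where the derivative is two-sided.\<close>

lemma halfline_nondecreasing:
  fixes f :: "real \<Rightarrow> real"
  assumes f: "\<And>t. 0 \<le> t \<Longrightarrow> (f has_real_derivative f' t) (at t within {0..})"
    and nn: "\<And>t. 0 \<le> t \<Longrightarrow> 0 \<le> f' t" and st: "0 \<le> s" "s \<le> t"
  shows "f s \<le> f t"
proof (rule DERIV_nonneg_imp_increasing_open[of s t f])
  show "\<exists>y. (f has_real_derivative y) (at x) \<and> 0 \<le> y" if "s < x" "x < t" for x
    using f[of x] nn[of x] that st by (intro exI[of _ "f' x"]) (simp add: at_within_halfline)
  have "continuous_on {0..} f" using f by (intro DERIV_continuous_on) auto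
  then show "continuous_on {s..t} f" by (rule continuous_on_subset) (use st in auto)
qed (rule st)

locale damping =
  fixes b :: "real \<Rightarrow> real"
  assumes effective: "effective_damping b"
begin

abbreviation "B \<equiv> Bfun b"

lemma b_pos: "0 \<le> t \<Longrightarrow> 0 < b t"
  using effective by (auto simp: effective_damping_def)

lemma b_deriv: "0 \<le> t \<Longrightarrow> (b has_real_derivative hderiv b t) (at t within {0..})"
  using effective by (intro has_real_derivative_hderiv) (auto simp: effective_damping_def C2_halfline_def)

lemma continuous_b: "continuous_on {0..} b"
  using b_deriv by (intro DERIV_continuous_on) auto

lemma continuous_hderiv_b: "continuous_on {0..} (hderiv b)"
  using effective by (auto simp: effective_damping_def C2_halfline_def intro: differentiable_imp_continuous_on)

lemma continuous_inverse_b: "continuous_on {0..} (\<lambda>t. 1 / b t)"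
  by (intro continuous_intros continuous_b) (use b_pos in force)

lemma B_0 [simp]: "B 0 = 0"
  by (simp add: Bfun_def)

lemma B_deriv: "(B has_real_derivative 1 / b t) (at t within {0..})" if "0 \<le> t"
proof -
  have "((\<lambda>u. integral {0..u} (\<lambda>\<tau>. 1 / b \<tau>)) has_vector_derivative 1 / b t) (at t within {0..t + 1})"
    using that by (intro integral_has_vector_derivative continuous_on_subset[OF continuous_inverse_b]) auto
  \<comment> \<open>The upper end \<open>t + 1\<close> lies beyond \<open>t\<close>, so near
    \<open>t\<close> the interval and the half line coincide.\<close>
  moreover have "at t within {0..t + 1} = at t within {0..}"
    by (rule at_within_nhd[of t "{..<t + 1}"]) auto
  ultimately show ?thesis
    by (simp add: Bfun_def[abs_def] has_real_derivative_iff_has_vector_derivative)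
qed

lemma B_mono: "0 \<le> s \<Longrightarrow> s \<le> t \<Longrightarrow> B s \<le> B t"
  by (rule halfline_nondecreasing[OF B_deriv]) (simp_all add: b_pos less_imp_le)

lemma B_strict_mono: "B s < B t" if "0 \<le> s" "s < t"
proof (rule DERIV_pos_imp_increasing_open[of s t B])
  show "\<exists>y. (B has_real_derivative y) (at x) \<and> 0 < y" if "s < x" "x < t" for x
    using B_deriv[of x] b_pos[of x] that \<open>0 \<le> s\<close> by (intro exI[of _ "1 / b x"]) (simp add: at_within_halfline)
  have "continuous_on {0..} B" using B_deriv by (intro DERIV_continuous_on) auto
  then show "continuous_on {s..t} B" by (rule continuous_on_subset) (use that in auto)
qed fact

lemma B_nonneg: "0 \<le> B t"
proof (cases "0 \<le> t")
  case True
  then show ?thesis using B_mono[of 0 t] by simp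
next
  case False
  then show ?thesis by (simp add: Bfun_def)
qed

text \<open>For negative arguments the interval of integration is empty and \<open>B\<close> is 0.
  Monotonicity on the whole line gives Borel measurability of \<open>B\<close>, and later of
  \<open>h\<close>, without cutting to the half line.\<close>

lemma B_mono_real: "mono B"
proof (rule monoI)
  fix s t :: real assume "s \<le> t"
  then show "B s \<le> B t"
  proof (cases "0 \<le> s")
    case False
    then have "B s = 0" by (simp add: Bfun_def)
    then show ?thesis by (simp add: B_nonneg)
  qed (simp add: B_mono)
qed

lemma measurable_B [measurable]: "B \<in> borel_measurable borel"
  by (rule borel_measurable_mono[OF B_mono_real])

lemma continuous_B: "continuous_on {0..} B"
  using B_deriv by (intro DERIV_continuous_on) auto

text \<open>From t b' \<le> b it follows that b(t)/t is nonincreasing on [1, \<infinity>). Hence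
  b(t) \<le> b(1) t, and integrating 1/b bounds B(t) below by ln t / b(1).\<close>

lemma filterlim_B: "filterlim B at_top at_top"
proof -
  obtain a0 where a0: "a0 < 1" "\<And>t. 0 \<le> t \<Longrightarrow> t * hderiv b t \<le> a0 * b t"
    using effective by (auto simp: effective_damping_def)
  have tb: "t * hderiv b t \<le> b t" if "0 \<le> t" for t
  proof -
    have "a0 * b t \<le> 1 * b t" using a0(1) b_pos[OF that] by (intro mult_right_mono) auto
    then show ?thesis using a0(2)[OF that] by simp
  qed
  have db: "(b has_real_derivative hderiv b t) (at t)" if "0 < t" for t
    using b_deriv[of t] that by (simp add: at_within_halfline)
  have dB: "(B has_real_derivative 1 / b t) (at t)" if "0 < t" for t
    using B_deriv[of t] that by (simp add: at_within_halfline)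
  have le: "b t \<le> b 1 * t" if "1 \<le> t" for t
  proof -
    have "- (b 1 / 1) \<le> - (b t / t)"
    proof (rule DERIV_nonneg_imp_nondecreasing[OF that])
      fix x :: real assume x: "1 \<le> x"
      have "((\<lambda>t. - (b t / t)) has_real_derivative - ((hderiv b x * x - b x * 1) / (x * x))) (at x)"
        by (intro DERIV_minus DERIV_divide db DERIV_ident) (use x in auto)
      moreover have "- ((hderiv b x * x - b x * 1) / (x * x)) \<ge> 0"
        using tb[of x] x by (simp add: divide_nonpos_nonneg mult.commute)
      ultimately show "\<exists>y. ((\<lambda>t. - (b t / t)) has_real_derivative y) (at x) \<and> 0 \<le> y" by blast
    qed
    then show ?thesis using that by (simp add: pos_divide_le_eq)
  qed
  have ge: "ln t / b 1 \<le> B t" if "1 \<le> t" for t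
  proof -
    have "B 1 - ln 1 / b 1 \<le> B t - ln t / b 1"
    proof (rule DERIV_nonneg_imp_nondecreasing[OF that])
      fix x :: real assume x: "1 \<le> x"
      have "((\<lambda>t. B t - ln t / b 1) has_real_derivative 1 / b x - 1 / x / b 1) (at x)"
        by (intro DERIV_diff DERIV_cdivide dB DERIV_ln_divide) (use x in auto)
      moreover have "1 / b x - 1 / x / b 1 \<ge> 0"
      proof -
        have "1 / (b 1 * x) \<le> 1 / b x"
          using le[OF x] b_pos[of x] x by (intro divide_left_mono) auto
        then show ?thesis by (simp add: mult.commute)
      qed
      ultimately show "\<exists>y. ((\<lambda>t. B t - ln t / b 1) has_real_derivative y) (at x) \<and> 0 \<le> y" by blast
    qed
    then show ?thesis using B_nonneg[of 1] by simp
  qed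
  have "filterlim (\<lambda>t. ln t * (1 / b 1)) at_top at_top"
    by (rule filterlim_at_top_mult_tendsto_pos[OF tendsto_const _ ln_at_top]) (use b_pos in auto)
  then show ?thesis
    by (rule filterlim_at_top_mono) (use ge in \<open>auto intro: eventually_mono[OF eventually_ge_at_top[of 1]]\<close>)
qed

text \<open>Every parabolic radius \<open>R\<close> thereby has a terminal time
  \<open>\<tau>\<close>, which converts conditions on radii into conditions on times such as \<tau>
  < T.\<close>

lemma B_surj:
  assumes "1 \<le> R"
  obtains \<tau> where "0 \<le> \<tau>" "1 + B \<tau> = R"
proof -
  obtain t where t: "0 \<le> t" "R \<le> B t"
    using filterlim_B unfolding filterlim_at_top
    by (metis eventually_at_top_linorder linorder_linear)
  have "\<exists>\<tau>. 0 \<le> \<tau> \<and> \<tau> \<le> t \<and> B \<tau> = R - 1"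
    by (rule IVT') (use t assms in \<open>auto intro: continuous_on_subset[OF continuous_B]\<close>)
  then show ?thesis using that by force
qed

text \<open>The first bound integrates \<open>(b\<^bsup>-2\<^esup>)' = -2b'/b\<^sup>3 \<le> C/b = C B'\<close>, using that \<open>(1 + t) b(t)\<close> is bounded below.\<close>

lemma damping_ratios_bounded:
  obtains K where "K > 0" "\<And>t. 0 \<le> t \<Longrightarrow> 1 / (b t)\<^sup>2 \<le> K * (1 + B t)"
    "\<And>t. 0 \<le> t \<Longrightarrow> \<bar>hderiv b t\<bar> / (b t)\<^sup>2 \<le> K"
proof -
  obtain C where C: "C > 0" "\<And>t. 0 \<le> t \<Longrightarrow> \<bar>hderiv b t\<bar> \<le> C * b t / (1 + t)"
    using effective by (auto simp: effective_damping_def symbol_bounds_def)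
  have "filterlim (\<lambda>t. t * b t) at_top at_top" using effective by (auto simp: effective_damping_def)
  then obtain T where T: "\<And>t. T \<le> t \<Longrightarrow> 1 \<le> t * b t"
    unfolding filterlim_at_top by (metis eventually_at_top_linorder)
  have "\<exists>x\<in>{0..max T 0}. \<forall>y\<in>{0..max T 0}. (1 + x) * b x \<le> (1 + y) * b y"
    by (intro continuous_attains_inf continuous_intros continuous_on_subset[OF continuous_b]) auto
  then obtain x where x: "0 \<le> x" "\<And>y. 0 \<le> y \<Longrightarrow> y \<le> max T 0 \<Longrightarrow> (1 + x) * b x \<le> (1 + y) * b y"
    by auto
  \<comment> \<open>For large t the product t b(t) is at least 1; on the remaining compact interval
    the minimum of (1 + t) b(t) is attained and positive.\<close>
  define c where "c = min 1 ((1 + x) * b x)"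
  have c: "c > 0" using x(1) b_pos[of x] by (simp add: c_def)
  have cb: "c \<le> (1 + t) * b t" if t: "0 \<le> t" for t
  proof (cases "t \<le> max T 0")
    case True
    then show ?thesis using x(2)[OF t] by (simp add: c_def min_def)
  next
    case False
    then have "1 \<le> t * b t" using T[of t] by simp
    then show ?thesis using b_pos[OF t] by (simp add: c_def min_def algebra_simps)
  qed
  have q: "\<bar>hderiv b t\<bar> / (b t)\<^sup>2 \<le> C / c" if t: "0 \<le> t" for t
  proof -
    have "\<bar>hderiv b t\<bar> / (b t)\<^sup>2 \<le> (C * b t / (1 + t)) / (b t)\<^sup>2"
      by (intro divide_right_mono C t) simp
    also have "\<dots> = C / ((1 + t) * b t)" using b_pos[OF t] t by (simp add: power2_eq_square)
    also have "\<dots> \<le> C / c" using cb[OF t] c C b_pos[OF t] t by (intro divide_left_mono) auto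
    finally show ?thesis .
  qed
  \<comment> \<open>The summand \<open>1 / (b 0)\<^sup>2\<close> settles the comparison at t = 0.
    The derivative of b^(-2) is (1/b)(-2 b'/b^2), and twice \<open>C / c\<close> bounds the second
    factor.\<close>
  define K where "K = 2 * C / c + 1 / (b 0)\<^sup>2"
  have Cc: "C / c > 0" using C c by simp
  have K: "K > 0" "C / c \<le> K" "2 * (C / c) \<le> K" "1 / (b 0)\<^sup>2 \<le> K"
  proof -
    have "K = 2 * (C / c) + 1 / (b 0)\<^sup>2" "1 / (b 0)\<^sup>2 > 0"
      using b_pos[of 0] by (simp_all add: K_def)
    then show "K > 0" "C / c \<le> K" "2 * (C / c) \<le> K" "1 / (b 0)\<^sup>2 \<le> K" using Cc by linarith+
  qed
  have "1 / (b t)\<^sup>2 \<le> K * (1 + B t)" if t: "0 \<le> t" for t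
  proof -
    let ?f = "\<lambda>t. K * (1 + B t) - inverse ((b t)\<^sup>2)"
    let ?f' = "\<lambda>s. K * (0 + 1 / b s)
          - - (inverse ((b s)\<^sup>2) * (2 * (hderiv b s * b s)) * inverse ((b s)\<^sup>2))"
    have "?f 0 \<le> ?f t"
    proof (rule halfline_nondecreasing[where f = ?f and f' = ?f'])
      fix s :: real assume s: "0 \<le> s"
      have d1: "((\<lambda>t. K * (1 + B t)) has_real_derivative K * (0 + 1 / b s)) (at s within {0..})"
        by (rule DERIV_cmult[OF DERIV_add[OF DERIV_const B_deriv[OF s]]])
      have d2: "((\<lambda>t. (b t)\<^sup>2) has_real_derivative 2 * (hderiv b s * b s)) (at s within {0..})"
        using DERIV_power[OF b_deriv[OF s], of 2] by simp
      show "(?f has_real_derivative ?f' s) (at s within {0..})"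
        using b_pos[OF s] by (intro DERIV_diff d1 DERIV_inverse'[OF d2]) auto
      have "- hderiv b s / (b s)\<^sup>2 \<le> C / c"
        using q[OF s] by (meson abs_ge_minus_self divide_right_mono order_trans zero_le_power2)
      then have "0 \<le> (K + 2 * (hderiv b s / (b s)\<^sup>2)) / b s"
        using K(3) b_pos[OF s] by (intro divide_nonneg_pos) auto
      also have "\<dots> = ?f' s"
        using b_pos[OF s] by (simp add: field_simps power2_eq_square)
      finally show "0 \<le> ?f' s" .
    qed (use t in auto)
    then show ?thesis using K(4) by (simp add: divide_inverse)
  qed
  then show ?thesis using order_trans[OF q K(2)] K(1) by (intro that[of K])
qed

end

section \<open>The test functions\<close>

text \<open>The cutoff enters only through the listed properties; \<open>cutoff_exists\<close>
  supplies an instance in the proof of \<open>theorem19\<close>.\<close>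

locale test_family = damping +
  fixes m \<rho> \<psi> \<psi>' \<psi>'' :: "real \<Rightarrow> real" and \<beta> T\<^sub>0 p K\<^sub>\<psi> :: real
  assumes p: "p > 1"
    and balance: "mass_balance b m \<beta> T\<^sub>0"
    and slow: "slow_adjoint_solution b m \<beta> T\<^sub>0 \<rho>"
    and \<psi>_deriv: "\<And>s. (\<psi> has_real_derivative \<psi>' s) (at s)"
    and \<psi>'_deriv: "\<And>s. (\<psi>' has_real_derivative \<psi>'' s) (at s)"
    and continuous_\<psi>'': "continuous_on UNIV \<psi>''"
    and \<psi>_1: "\<And>s. s \<le> 1 / 2 \<Longrightarrow> \<psi> s = 1"
    and \<psi>_0: "\<And>s. s \<ge> 1 \<Longrightarrow> \<psi> s = 0"
    and \<psi>'_0: "\<And>s. s \<le> 1 / 2 \<or> s \<ge> 1 \<Longrightarrow> \<psi>' s = 0"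
    and \<psi>''_0: "\<And>s. s \<le> 1 / 2 \<or> s \<ge> 1 \<Longrightarrow> \<psi>'' s = 0"
    and \<psi>'_nonpos: "\<And>s. \<psi>' s \<le> 0"
    and K\<^sub>\<psi>_pos: "K\<^sub>\<psi> > 0"
    and \<psi>'_le: "\<And>s. \<bar>\<psi>' s\<bar> \<le> K\<^sub>\<psi> * (- \<psi>' s) powr (1 / p)"
    and \<psi>''_le: "\<And>s. \<bar>\<psi>'' s\<bar> \<le> K\<^sub>\<psi> * (- \<psi>' s) powr (1 / p)"
begin

lemma continuous_\<psi>: "continuous_on S \<psi>"
  by (rule DERIV_continuous_on[OF has_field_derivative_at_within[OF \<psi>_deriv]])

lemma continuous_\<psi>': "continuous_on S \<psi>'"
  by (rule DERIV_continuous_on[OF has_field_derivative_at_within[OF \<psi>'_deriv]])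

lemma \<psi>_antimono: "s \<le> t \<Longrightarrow> \<psi> t \<le> \<psi> s"
  by (rule DERIV_nonpos_imp_nonincreasing[of s t \<psi>]) (use \<psi>_deriv \<psi>'_nonpos in blast)+

lemma \<psi>_nonneg: "0 \<le> \<psi> s"
  using \<psi>_antimono[of s "max s 1"] \<psi>_0[of "max s 1"] by simp

lemma \<psi>_le_1: "\<psi> s \<le> 1"
  using \<psi>_antimono[of "min s (1 / 2)" s] \<psi>_1[of "min s (1 / 2)"] by simp

lemma \<rho>_deriv: "0 \<le> t \<Longrightarrow> (\<rho> has_real_derivative hderiv \<rho> t) (at t within {0..})"
  using slow by (intro has_real_derivative_hderiv) (auto simp: slow_adjoint_solution_def C2_halfline_def)

lemma hderiv_\<rho>_deriv:
  "0 \<le> t \<Longrightarrow> (hderiv \<rho> has_real_derivative hderiv (hderiv \<rho>) t) (at t within {0..})"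
  using slow by (intro has_real_derivative_hderiv) (auto simp: slow_adjoint_solution_def C2_halfline_def)

lemma continuous_hderiv2_\<rho>: "continuous_on {0..} (hderiv (hderiv \<rho>))"
  using slow by (auto simp: slow_adjoint_solution_def C2_halfline_def)

lemma continuous_\<rho>: "continuous_on {0..} \<rho>"
  using \<rho>_deriv by (intro DERIV_continuous_on) auto

lemma \<rho>_pos: "0 \<le> t \<Longrightarrow> 0 < \<rho> t"
  using slow unfolding slow_adjoint_solution_def by blast

lemma adjoint_equation:
  "0 \<le> t \<Longrightarrow> hderiv (hderiv \<rho>) t - hderiv (\<lambda>s. b s * \<rho> s) t + (m t)\<^sup>2 * \<rho> t = 0"
  using slow unfolding slow_adjoint_solution_def by blast

lemma \<rho>_bounds:
  obtains C where "C > 0" "\<And>t. 0 \<le> t \<Longrightarrow> \<bar>hderiv \<rho> t\<bar> \<le> C * b t * \<rho> t"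
    "\<And>t. 0 \<le> t \<Longrightarrow>
      b t * \<rho> t \<le> C * (1 + B t) powr \<beta> * exp (Omega b m \<beta> T\<^sub>0 (ln (1 + B t)))"
  using slow unfolding slow_adjoint_solution_def by blast

section \<open>Parabolic regions and admissibility of the test functions\<close>

definition h :: "real \<times> (real ^ 'n::finite) \<Rightarrow> real" where
  "h z = 1 + B (fst z) + (norm (snd z))\<^sup>2"

definition test_fn :: "real \<Rightarrow> real \<times> (real ^ 'n::finite) \<Rightarrow> real" where
  "test_fn R z = \<rho> (fst z) * \<psi> (h z / R)"

definition region :: "real \<Rightarrow> (real \<times> (real ^ 'n::finite)) set" where
  "region R = {z. 0 \<le> fst z \<and> h z \<le> R}"

lemma h_ge_1: "1 \<le> h z"
  using B_nonneg[of "fst z"] by (simp add: h_def)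

lemma continuous_h: "continuous_on ({0..} \<times> UNIV) h"
  unfolding h_def[abs_def] by (intro continuous_intros continuous_on_compose2[OF continuous_B]) auto

lemma measurable_h [measurable]: "(h :: real \<times> (real ^ 'n::finite) \<Rightarrow> real) \<in> borel_measurable borel"
proof -
  have "(\<lambda>z :: real \<times> (real ^ 'n). B (fst z)) \<in> borel_measurable borel"
    by (rule measurable_compose[OF _ measurable_B])
      (intro borel_measurable_continuous_onI continuous_intros)
  moreover have "(\<lambda>z :: real \<times> (real ^ 'n). (norm (snd z))\<^sup>2) \<in> borel_measurable borel"
    by (intro borel_measurable_continuous_onI continuous_intros)
  ultimately show ?thesis unfolding h_def[abs_def] by (intro borel_measurable_add) auto
qed

text \<open>Strict monotonicity of \<open>B\<close> turns h \<le> R into a bound on time. The box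
  gives both compactness of the region and a product set on which its mass can be estimated.\<close>

lemma region_subset:
  assumes "0 \<le> \<tau>" "R = 1 + B \<tau>"
  shows "region R \<subseteq> {0..\<tau>} \<times> cball (0 :: real ^ 'n::finite) (sqrt R)"
proof clarify
  fix t and x :: "real ^ 'n" assume "(t, x) \<in> region R"
  then have tx: "0 \<le> t" "1 + B t + (norm x)\<^sup>2 \<le> 1 + B \<tau>"
    by (auto simp: region_def h_def assms)
  have "t \<le> \<tau>"
  proof (rule ccontr)
    assume "\<not> t \<le> \<tau>"
    then have "B \<tau> < B t" using assms by (intro B_strict_mono) auto
    moreover have "0 \<le> (norm x)\<^sup>2" by simp
    ultimately show False using tx by linarith
  qed
  moreover have "norm x \<le> sqrt R"
    using tx B_nonneg[of t] by (intro real_le_rsqrt) (simp add: assms)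
  ultimately show "t \<in> {0..\<tau>} \<and> x \<in> cball 0 (sqrt R)" using tx by simp
qed

lemma closed_region: "closed (region R :: (real \<times> (real ^ 'n::finite)) set)"
proof -
  have "closed {z \<in> {0..} \<times> (UNIV :: (real ^ 'n) set). h z \<le> R}"
    by (intro continuous_on_closed_Collect_le continuous_h continuous_on_const closed_Times) auto
  also have "{z \<in> {0..} \<times> (UNIV :: (real ^ 'n) set). h z \<le> R} = region R"
    by (auto simp: region_def)
  finally show ?thesis .
qed

lemma compact_region:
  assumes "1 \<le> R"
  shows "compact (region R :: (real \<times> (real ^ 'n::finite)) set)"
proof -
  obtain \<tau> where \<tau>: "0 \<le> \<tau>" "R = 1 + B \<tau>" using B_surj[OF assms] by metis
  have "bounded (region R :: (real \<times> (real ^ 'n)) set)"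
    by (rule bounded_subset[OF _ region_subset[OF \<tau>]]) (intro bounded_Times bounded_cball bounded_closed_interval)
  then show ?thesis using closed_region by (simp add: compact_eq_bounded_closed)
qed

lemma region_subset_cyl:
  assumes "0 \<le> \<tau>" "R = 1 + B \<tau>" "ereal \<tau> < T"
  shows "region R \<subseteq> cyl T"
proof
  fix z assume "z \<in> region R"
  with region_subset[OF assms(1,2)] have "0 \<le> fst z" "fst z \<le> \<tau>" by auto
  then show "z \<in> cyl T" using assms(3) by (auto simp: cyl_def intro: le_less_trans[of _ "ereal \<tau>"])
qed

lemma test_fn_eq_0: "0 \<le> fst z \<Longrightarrow> z \<notin> region R \<Longrightarrow> 0 < R \<Longrightarrow> test_fn R z = 0"
  by (simp add: region_def test_fn_def \<psi>_0)

text \<open>\<open>B\<close> is twice continuously differentiable because its derivative 1/b is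
  continuously differentiable. The squared norm is expanded into products of linear coordinates so
  that the closure rules apply.\<close>

lemma C2_on_h:
  assumes "S \<subseteq> {0..} \<times> (UNIV :: (real ^ 'n::finite) set)"
  shows "C2_on S h"
proof -
  have fst: "C2_on S fst" by (rule C2_on_linear[OF bounded_linear_fst])
  have B'': "((\<lambda>t. 1 / b t) has_real_derivative - hderiv b t / (b t)\<^sup>2) (at t within {0..})" if "0 \<le> t" for t
    using DERIV_divide[OF DERIV_const b_deriv[OF that], of 1] b_pos[OF that]
    by (simp add: power2_eq_square)
  have "C2_on S (\<lambda>z. B (fst z))"
    by (rule C2_on_compose[OF fst _ B_deriv B''])
      (use assms b_pos in \<open>force intro!: continuous_intros continuous_b continuous_hderiv_b\<close>)+
  moreover have "C2_on S (\<lambda>z. \<Sum>i\<in>UNIV. snd z $ i * snd z $ i)"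
    by (intro C2_on_sum C2_on_mult C2_on_linear bounded_linear_compose[OF bounded_linear_vec_nth bounded_linear_snd])
  ultimately have "C2_on S (\<lambda>z. 1 + B (fst z) + (\<Sum>i\<in>UNIV. snd z $ i * snd z $ i))"
    by (intro C2_on_add C2_on_const)
  moreover have "(norm x)\<^sup>2 = (\<Sum>i\<in>UNIV. x $ i * x $ i)" for x :: "real ^ 'n"
    by (simp add: power2_norm_eq_inner inner_vec_def)
  ultimately show ?thesis unfolding h_def[abs_def] by simp
qed

lemma C2_on_test_fn:
  assumes "S \<subseteq> {0..} \<times> (UNIV :: (real ^ 'n::finite) set)"
  shows "C2_on S (test_fn R)"
proof -
  have "C2_on S (\<lambda>z. \<rho> (fst z))"
    by (rule C2_on_compose[OF C2_on_linear[OF bounded_linear_fst] _ \<rho>_deriv hderiv_\<rho>_deriv continuous_hderiv2_\<rho>])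
      (use assms in auto)
  moreover have "C2_on S (\<lambda>z. h z / R)"
    using C2_on_mult[OF C2_on_h[OF assms] C2_on_const, of "1 / R"] by simp
  then have "C2_on S (\<lambda>z. \<psi> (h z / R))"
    by (rule C2_on_compose[OF _ subset_UNIV \<psi>_deriv \<psi>'_deriv continuous_\<psi>''])
  ultimately show ?thesis unfolding test_fn_def[abs_def] by (rule C2_on_mult)
qed

text \<open>The support lies in \<open>region R\<close>, hence in times up to \<open>\<tau>\<close>;
  the strict inequality with \<open>T\<close> keeps this compact set inside
  \<open>cyl T\<close>.\<close>

lemma test_function_test_fn:
  assumes "0 \<le> \<tau>" "R = 1 + B \<tau>" "ereal \<tau> < T"
  shows "test_function T (test_fn R :: real \<times> (real ^ 'n::finite) \<Rightarrow> real)"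
proof -
  let ?N = "{z \<in> cyl T. test_fn R (z :: real \<times> (real ^ 'n)) \<noteq> 0}"
  have R: "1 \<le> R" using assms B_nonneg[of \<tau>] by simp
  have "?N \<subseteq> region R" using test_fn_eq_0 R by (fastforce simp: cyl_def)
  then have c: "closure ?N \<subseteq> region R" by (rule closure_minimal[OF _ closed_region])
  then have "compact (closure ?N)"
    using compact_region[OF R] by (meson bounded_subset closed_closure compact_eq_bounded_closed)
  moreover have "C2_on (cyl T) (test_fn R :: real \<times> (real ^ 'n) \<Rightarrow> real)"
    by (rule C2_on_test_fn) (auto simp: cyl_def)
  ultimately show ?thesis
    unfolding test_function_def using c region_subset_cyl[OF assms] by blast
qed

section \<open>Derivatives of the test functions and the adjoint operator\<close>

lemma h_time_deriv:
  assumes "0 \<le> t"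
  shows "((\<lambda>s. h (s, x) / R) has_real_derivative 1 / b t / R) (at t within {0..})"
proof -
  have "((\<lambda>s. (1 + B s + (norm x)\<^sup>2) / R) has_real_derivative (0 + 1 / b t + 0) / R) (at t within {0..})"
    by (intro DERIV_cdivide DERIV_add DERIV_const B_deriv assms)
  then show ?thesis by (simp add: h_def)
qed

lemma dt_test_fn:
  assumes "0 \<le> t"
  shows "dt (test_fn R) (t, x) =
    hderiv \<rho> t * \<psi> (h (t, x) / R) + \<rho> t * (\<psi>' (h (t, x) / R) * (1 / b t / R))"
  unfolding dt_def fst_conv snd_conv
proof (rule hderiv_eqI[OF _ assms])
  show "((\<lambda>s. test_fn R (s, x)) has_real_derivative
      hderiv \<rho> t * \<psi> (h (t, x) / R) + \<rho> t * (\<psi>' (h (t, x) / R) * (1 / b t / R))) (at t within {0..})"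
    using DERIV_mult[OF \<rho>_deriv[OF assms] DERIV_chain2[OF \<psi>_deriv h_time_deriv[OF assms]], of x R]
    by (simp add: test_fn_def algebra_simps)
qed

lemma dt_dt_test_fn:
  assumes t: "0 \<le> t"
  shows "dt (dt (test_fn R)) (t, x) =
    hderiv (hderiv \<rho>) t * \<psi> (h (t, x) / R)
    + 2 * (hderiv \<rho> t * (\<psi>' (h (t, x) / R) * (1 / b t / R)))
    + \<rho> t * (\<psi>'' (h (t, x) / R) * (1 / b t / R)\<^sup>2 - \<psi>' (h (t, x) / R) * (hderiv b t / (b t)\<^sup>2 / R))"
    (is "_ = ?D")
  unfolding dt_def[of "dt _"] fst_conv snd_conv
proof (rule hderiv_eqI[OF _ t])
  let ?s = "\<lambda>t. h (t, x) / R"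
  have d\<psi>: "((\<lambda>t. \<psi> (?s t)) has_real_derivative \<psi>' (?s t) * (1 / b t / R)) (at t within {0..})"
    by (rule DERIV_chain2[OF \<psi>_deriv h_time_deriv[OF t]])
  have d\<psi>': "((\<lambda>t. \<psi>' (?s t)) has_real_derivative \<psi>'' (?s t) * (1 / b t / R)) (at t within {0..})"
    by (rule DERIV_chain2[OF \<psi>'_deriv h_time_deriv[OF t]])
  have db: "((\<lambda>t. 1 / b t / R) has_real_derivative (0 * b t - 1 * hderiv b t) / (b t * b t) / R) (at t within {0..})"
    by (intro DERIV_cdivide DERIV_divide DERIV_const b_deriv t) (use b_pos[OF t] in auto)
  have "((\<lambda>t. hderiv \<rho> t * \<psi> (?s t) + \<rho> t * (\<psi>' (?s t) * (1 / b t / R))) has_real_derivative ?D)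
      (at t within {0..})"
    by (rule DERIV_cong[OF DERIV_add[OF DERIV_mult[OF hderiv_\<rho>_deriv[OF t] d\<psi>]
          DERIV_mult[OF \<rho>_deriv[OF t] DERIV_mult[OF d\<psi>' db]]]])
      (simp add: algebra_simps power2_eq_square)
  \<comment> \<open>The formula for \<open>dt (test_fn R)\<close> is known only at nonnegative
    times, which are the only ones that a derivative within the half line sees.\<close>
  then show "((\<lambda>s. dt (test_fn R) (s, x)) has_real_derivative ?D) (at t within {0..})"
    by (rule has_field_derivative_transform_within[OF _ zero_less_one]) (use t in \<open>auto simp: dt_test_fn\<close>)
qed

text \<open>The derivative of b \<rho> stays unexpanded because the adjoint equation contains it in
  this form.\<close>

lemma dt_damped_test_fn:
  assumes t: "0 \<le> t"
  shows "dt (\<lambda>y. b (fst y) * test_fn R y) (t, x) =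
    hderiv (\<lambda>s. b s * \<rho> s) t * \<psi> (h (t, x) / R) + b t * \<rho> t * (\<psi>' (h (t, x) / R) * (1 / b t / R))"
  unfolding dt_def fst_conv snd_conv
proof (rule hderiv_eqI[OF _ t])
  have "((\<lambda>s. b s * \<rho> s) has_real_derivative hderiv b t * \<rho> t + hderiv \<rho> t * b t) (at t within {0..})"
    by (rule DERIV_mult[OF b_deriv[OF t] \<rho>_deriv[OF t]])
  then have "((\<lambda>s. b s * \<rho> s) has_real_derivative hderiv (\<lambda>s. b s * \<rho> s) t) (at t within {0..})"
    using hderiv_eqI[OF _ t] by metis
  from DERIV_mult[OF this DERIV_chain2[OF \<psi>_deriv h_time_deriv[OF t]], of x R]
  show "((\<lambda>s. b s * test_fn R (s, x)) has_real_derivative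
     hderiv (\<lambda>s. b s * \<rho> s) t * \<psi> (h (t, x) / R) + b t * \<rho> t * (\<psi>' (h (t, x) / R) * (1 / b t / R)))
     (at t within {0..})"
    by (simp add: test_fn_def algebra_simps)
qed

lemma h_space_deriv:
  "((\<lambda>s. h (t, x + s *\<^sub>R axis i 1) / R) has_real_derivative 2 * x $ i / R) (at 0)"
proof -
  have "(norm (x + s *\<^sub>R axis i 1))\<^sup>2 = (norm x)\<^sup>2 + 2 * s * x $ i + s\<^sup>2" for s
    unfolding power2_norm_eq_inner
    by (simp add: inner_add_left inner_add_right inner_axis inner_axis' power2_eq_square algebra_simps)
  then have "h (t, x + s *\<^sub>R axis i 1) / R = (h (t, x) + 2 * s * x $ i + s\<^sup>2) / R" for s
    by (simp only: h_def fst_conv snd_conv) simp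
  moreover have "((\<lambda>s. (h (t, x) + 2 * s * x $ i + s\<^sup>2) / R) has_real_derivative
      (0 + 2 * 1 * x $ i + 2 * 0 ^ (2 - Suc 0) * 1) / R) (at 0)"
    by (intro DERIV_cdivide) (auto intro!: derivative_eq_intros)
  ultimately show ?thesis by (simp only:) simp
qed

text \<open>An equality of functions, at negative times too, so that a second \<open>dx\<close> can
  be applied after rewriting.\<close>

lemma dx_test_fn:
  "dx (i :: 'n::finite) (test_fn R) = (\<lambda>z. \<rho> (fst z) * (\<psi>' (h z / R) * (2 * snd z $ i / R)))"
proof (rule ext, clarify)
  fix t and x :: "real ^ 'n"
  show "dx i (test_fn R) (t, x) = \<rho> (fst (t, x)) * (\<psi>' (h (t, x) / R) * (2 * snd (t, x) $ i / R))"
    unfolding dx_def test_fn_def fst_conv snd_conv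
  proof (intro DERIV_imp_deriv DERIV_cmult)
    show "((\<lambda>s. \<psi> (h (t, x + s *\<^sub>R axis i 1) / R)) has_real_derivative
        \<psi>' (h (t, x) / R) * (2 * x $ i / R)) (at 0)"
      by (rule DERIV_chain2[OF _ h_space_deriv]) (simp add: \<psi>_deriv)
  qed
qed

lemma dx_dx_test_fn:
  "dx i (dx i (test_fn R)) (t, x) =
    \<rho> t * (\<psi>'' (h (t, x) / R) * (2 * x $ i / R)\<^sup>2 + \<psi>' (h (t, x) / R) * (2 / R))"
  unfolding dx_test_fn unfolding dx_def fst_conv snd_conv
proof (intro DERIV_imp_deriv DERIV_cmult)
  have "((\<lambda>s. \<psi>' (h (t, x + s *\<^sub>R axis i 1) / R)) has_real_derivative
      \<psi>'' (h (t, x) / R) * (2 * x $ i / R)) (at 0)"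
    by (rule DERIV_chain2[OF _ h_space_deriv]) (simp add: \<psi>'_deriv)
  moreover have "((\<lambda>s. 2 * (x + s *\<^sub>R axis i 1) $ i / R) has_real_derivative 2 / R) (at 0)"
  proof -
    have "((\<lambda>s. 2 * (x $ i + s) / R) has_real_derivative 2 * (0 + 1) / R) (at 0)"
      by (intro DERIV_cdivide DERIV_cmult DERIV_add DERIV_const DERIV_ident)
    then show ?thesis by simp
  qed
  ultimately have "((\<lambda>s. \<psi>' (h (t, x + s *\<^sub>R axis i 1) / R) * (2 * (x + s *\<^sub>R axis i 1) $ i / R)) has_real_derivative
     \<psi>'' (h (t, x) / R) * (2 * x $ i / R) * (2 * (x + 0 *\<^sub>R axis i 1) $ i / R)
      + 2 / R * \<psi>' (h (t, x + 0 *\<^sub>R axis i 1) / R)) (at 0)"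
    by (rule DERIV_mult)
  then show "((\<lambda>s. \<psi>' (h (t, x + s *\<^sub>R axis i 1) / R) * (2 * (x + s *\<^sub>R axis i 1) $ i / R)) has_real_derivative
     \<psi>'' (h (t, x) / R) * (2 * x $ i / R)\<^sup>2 + \<psi>' (h (t, x) / R) * (2 / R)) (at 0)"
    by (rule DERIV_cong) (simp add: power2_eq_square mult.commute)
qed

lemma laplacian_test_fn:
  fixes x :: "real ^ 'n::finite"
  shows "laplacian (test_fn R) (t, x) =
    \<rho> t * (\<psi>'' (h (t, x) / R) * (4 * (norm x)\<^sup>2 / R\<^sup>2) + \<psi>' (h (t, x) / R) * (2 * CARD('n) / R))"
proof -
  have "(\<Sum>i\<in>UNIV. (2 * x $ i / R)\<^sup>2) = 4 * (norm x)\<^sup>2 / R\<^sup>2"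
    unfolding power2_norm_eq_inner inner_vec_def sum_distrib_left sum_divide_distrib
    by (simp add: power2_eq_square)
  then show ?thesis
    by (simp add: laplacian_def dx_dx_test_fn sum_distrib_left[symmetric] sum.distrib)
qed

text \<open>The formal adjoint operator on \<open>test_fn R\<close>, in the same shape as in
  \<open>weak_solution\<close>, so that both unfold to one term.\<close>

definition adj :: "real \<Rightarrow> real \<times> (real ^ 'n::finite) \<Rightarrow> real" where
  "adj R z = dt (dt (test_fn R)) z - laplacian (test_fn R) z
     - dt (\<lambda>y. b (fst y) * test_fn R y) z + (m (fst z))\<^sup>2 * test_fn R z"

text \<open>The terms with undifferentiated \<psi> cancel by the equation for \<rho>. Once \<rho>/R
  is factored out, the brackets hold only ratios that are bounded on the region; the final -1 is the
  contribution of the damping, as B' = 1/b.\<close>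

lemma adj_eq:
  fixes x :: "real ^ 'n::finite"
  assumes t: "0 \<le> t" and R: "0 < R"
  defines "s \<equiv> h (t, x) / R"
  shows "adj R (t, x) = \<rho> t / R * (\<psi>'' s * (1 / (b t)\<^sup>2 / R - 4 * ((norm x)\<^sup>2 / R))
    + \<psi>' s * (2 * (hderiv \<rho> t / (b t * \<rho> t)) - hderiv b t / (b t)\<^sup>2 - 2 * CARD('n) - 1))"
proof -
  have "adj R (t, x) = (hderiv (hderiv \<rho>) t - hderiv (\<lambda>s. b s * \<rho> s) t + (m t)\<^sup>2 * \<rho> t) * \<psi> s
    + 2 * (hderiv \<rho> t * (\<psi>' s * (1 / b t / R)))
    + \<rho> t * (\<psi>'' s * (1 / b t / R)\<^sup>2 - \<psi>' s * (hderiv b t / (b t)\<^sup>2 / R))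
    - \<rho> t * (\<psi>'' s * (4 * (norm x)\<^sup>2 / R\<^sup>2) + \<psi>' s * (2 * CARD('n) / R))
    - b t * \<rho> t * (\<psi>' s * (1 / b t / R))"
    unfolding adj_def s_def dt_dt_test_fn[OF t] laplacian_test_fn dt_damped_test_fn[OF t] fst_conv
    by (simp add: test_fn_def algebra_simps)
  also have "\<dots> = 2 * (hderiv \<rho> t * (\<psi>' s * (1 / b t / R)))
    + \<rho> t * (\<psi>'' s * (1 / b t / R)\<^sup>2 - \<psi>' s * (hderiv b t / (b t)\<^sup>2 / R))
    - \<rho> t * (\<psi>'' s * (4 * (norm x)\<^sup>2 / R\<^sup>2) + \<psi>' s * (2 * CARD('n) / R))
    - b t * \<rho> t * (\<psi>' s * (1 / b t / R))"
    by (simp add: adjoint_equation[OF t])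
  also have "\<dots> = \<rho> t / R * (\<psi>'' s * (1 / (b t)\<^sup>2 / R - 4 * ((norm x)\<^sup>2 / R))
    + \<psi>' s * (2 * (hderiv \<rho> t / (b t * \<rho> t)) - hderiv b t / (b t)\<^sup>2 - 2 * CARD('n) - 1))"
    using b_pos[OF t] \<rho>_pos[OF t] R by (simp add: field_simps power2_eq_square)
  finally show ?thesis .
qed

text \<open>On the region, 1/b^2 \<le> L (1 + B) \<le> L R and |x|^2 \<le> R control the factor of
  \<psi>'', while |\<rho>'| \<le> C b \<rho> and |b'| \<le> L b^2 control that of \<psi>'. Outside
  the region both derivatives of \<psi> vanish, which accounts for the indicator.\<close>

lemma adj_bound:
  obtains K where "K > 0"
    "\<And>z :: real \<times> (real ^ 'n::finite). \<And>R. 0 \<le> fst z \<Longrightarrow> 1 \<le> R \<Longrightarrow>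
       \<bar>adj R z\<bar> \<le> K * \<rho> (fst z) / R * ((- \<psi>' (h z / R)) powr (1 / p) * indicator (region R) z)"
proof -
  obtain C where C: "C > 0" "\<And>t. 0 \<le> t \<Longrightarrow> \<bar>hderiv \<rho> t\<bar> \<le> C * b t * \<rho> t"
    using \<rho>_bounds by metis
  obtain L where L: "L > 0" "\<And>t. 0 \<le> t \<Longrightarrow> 1 / (b t)\<^sup>2 \<le> L * (1 + B t)"
    "\<And>t. 0 \<le> t \<Longrightarrow> \<bar>hderiv b t\<bar> / (b t)\<^sup>2 \<le> L"
    using damping_ratios_bounded by metis
  define n where "n = real CARD('n)"
  define K where "K = K\<^sub>\<psi> * ((L + 4) + (2 * C + L + 2 * n + 1))"
  have K: "K > 0" using K\<^sub>\<psi>_pos C L by (simp add: K_def n_def)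
  have "\<bar>adj R (t, x)\<bar> \<le> K * \<rho> t / R * ((- \<psi>' (h (t, x) / R)) powr (1 / p) * indicator (region R) (t, x))"
    if t: "0 \<le> t" and R: "1 \<le> R" for t R and x :: "real ^ 'n"
  proof (cases "(t, x) \<in> region R")
    case False
    then have "h (t, x) / R \<ge> 1" using t R by (simp add: region_def)
    then show ?thesis using adj_eq[OF t, of R x] R False by (simp add: \<psi>'_0 \<psi>''_0)
  next
    case True
    then have hR: "1 + B t + (norm x)\<^sup>2 \<le> R" by (simp add: region_def h_def)
    define X where "X = (- \<psi>' (h (t, x) / R)) powr (1 / p)"
    have X: "0 \<le> X" by (simp add: X_def)
    have "1 / (b t)\<^sup>2 / R \<le> L"
    proof -
      have "1 / (b t)\<^sup>2 \<le> L * (1 + B t)" by (rule L(2)[OF t])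
      also have "\<dots> \<le> L * R"
      proof -
        have "1 + B t \<le> R" using hR zero_le_power2[of "norm x"] by linarith
        then show ?thesis using L(1) by simp
      qed
      finally show ?thesis using R by (subst pos_divide_le_eq) auto
    qed
    moreover have "0 \<le> 1 / (b t)\<^sup>2 / R" using R by simp
    moreover have "(norm x)\<^sup>2 / R \<le> 1" using hR B_nonneg[of t] R by (simp add: pos_divide_le_eq)
    moreover have "0 \<le> (norm x)\<^sup>2 / R" using R by simp
    ultimately have c2: "\<bar>1 / (b t)\<^sup>2 / R - 4 * ((norm x)\<^sup>2 / R)\<bar> \<le> L + 4" using L(1) by linarith
    have "\<bar>hderiv \<rho> t / (b t * \<rho> t)\<bar> \<le> C"
      using C(2)[OF t] b_pos[OF t] \<rho>_pos[OF t] by (simp add: abs_mult pos_divide_le_eq mult.assoc)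
    moreover have "\<bar>hderiv b t / (b t)\<^sup>2\<bar> \<le> L" using L(3)[OF t] by simp
    moreover have "0 \<le> n" by (simp add: n_def)
    ultimately have c1: "\<bar>2 * (hderiv \<rho> t / (b t * \<rho> t)) - hderiv b t / (b t)\<^sup>2 - 2 * n - 1\<bar>
        \<le> 2 * C + L + 2 * n + 1" by linarith
    have "\<bar>\<psi>'' (h (t, x) / R) * (1 / (b t)\<^sup>2 / R - 4 * ((norm x)\<^sup>2 / R))
      + \<psi>' (h (t, x) / R) * (2 * (hderiv \<rho> t / (b t * \<rho> t)) - hderiv b t / (b t)\<^sup>2 - 2 * n - 1)\<bar>
      \<le> (K\<^sub>\<psi> * X) * (L + 4) + (K\<^sub>\<psi> * X) * (2 * C + L + 2 * n + 1)"
      unfolding X_def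
      by (intro order_trans[OF abs_triangle_ineq] add_mono, unfold abs_mult)
        (intro mult_mono \<psi>''_le \<psi>'_le c1 c2; use K\<^sub>\<psi>_pos in simp)+
    also have "\<dots> = K * X" by (simp add: K_def algebra_simps)
    finally have "\<rho> t / R * \<bar>\<psi>'' (h (t, x) / R) * (1 / (b t)\<^sup>2 / R - 4 * ((norm x)\<^sup>2 / R))
      + \<psi>' (h (t, x) / R) * (2 * (hderiv \<rho> t / (b t * \<rho> t)) - hderiv b t / (b t)\<^sup>2 - 2 * n - 1)\<bar>
      \<le> \<rho> t / R * (K * X)"
      using \<rho>_pos[OF t] R by (intro mult_left_mono) auto
    then have "\<bar>adj R (t, x)\<bar> \<le> \<rho> t / R * (K * X)"
      using adj_eq[OF t, of R x] \<rho>_pos[OF t] R by (simp add: abs_mult n_def)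
    then show ?thesis using True by (simp add: X_def mult.commute mult.left_commute)
  qed
  then show ?thesis using K by (intro that[of K]) auto
qed

subsection \<open>The data term and the mass of the parabolic region\<close>

lemma \<psi>'_bounded:
  obtains M where "M > 0" "\<And>s. \<bar>\<psi>' s\<bar> \<le> M"
proof -
  have "compact (\<psi>' ` {1 / 2..1})"
    by (intro compact_continuous_image continuous_\<psi>' compact_Icc)
  then obtain M where M: "M > 0" "\<And>s. s \<in> {1 / 2..1} \<Longrightarrow> \<bar>\<psi>' s\<bar> \<le> M"
    by (auto dest!: compact_imp_bounded simp: bounded_pos)
  have "\<bar>\<psi>' s\<bar> \<le> M" for s
  proof (cases "s \<in> {1 / 2..1}")
    case False
    then have "s \<le> 1 / 2 \<or> s \<ge> 1" by auto
    then show ?thesis using \<psi>'_0[of s] M(1) by simp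
  qed (rule M(2))
  then show ?thesis using M(1) that by blast
qed

lemma measurable_\<psi>: "(\<lambda>z :: real \<times> (real ^ 'n::finite). \<psi> (h z / R)) \<in> borel_measurable borel"
  by (rule borel_measurable_continuous_onI[OF continuous_\<psi>, THEN measurable_compose[rotated]])
    (intro borel_measurable_divide measurable_h borel_measurable_const)

lemma measurable_\<psi>': "(\<lambda>z :: real \<times> (real ^ 'n::finite). \<psi>' (h z / R)) \<in> borel_measurable borel"
  by (rule borel_measurable_continuous_onI[OF continuous_\<psi>', THEN measurable_compose[rotated]])
    (intro borel_measurable_divide measurable_h borel_measurable_const)

text \<open>A slice of a Lebesgue measurable function need not be measurable. Borel measurability
  survives slicing, and only afterwards is the measure completed.\<close>

lemma measurable_slice:
  fixes F :: "real \<times> (real ^ 'n::finite) \<Rightarrow> real"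
  assumes "F \<in> borel_measurable borel"
  shows "(\<lambda>x. F (0, x)) \<in> borel_measurable lebesgue"
proof -
  have "(\<lambda>x :: real ^ 'n. (0 :: real, x)) \<in> borel_measurable borel"
    by (intro borel_measurable_continuous_onI continuous_intros)
  from measurable_compose[OF this assms] show ?thesis
    by (intro measurable_completion) simp
qed

text \<open>For fixed x and R \<ge> 2 h(0, x) the cutoff equals 1 and its derivative 0, so the
  integrand is eventually constant in R; multiples of |f| and |g| dominate it for R \<ge> 1. This
  limit is the origin of J_0.\<close>

lemma data_term_tendsto:
  fixes f g :: "real ^ 'n::finite \<Rightarrow> real"
  assumes f: "integrable lebesgue f" and g: "integrable lebesgue g"
  shows "((\<lambda>R. LINT x|lebesgue. g x * test_fn R (0, x) + b 0 * f x * test_fn R (0, x)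
              - f x * dt (test_fn R) (0, x))
    \<longlongrightarrow> \<rho> 0 * (LINT x|lebesgue. g x) + (b 0 * \<rho> 0 - hderiv \<rho> 0) * (LINT x|lebesgue. f x)) at_top"
proof -
  obtain M where M: "M > 0" "\<And>s. \<bar>\<psi>' s\<bar> \<le> M" using \<psi>'_bounded by blast
  let ?s = "\<lambda>R x. \<psi> (h (0, x) / R)" and ?s' = "\<lambda>R x. \<psi>' (h (0, x) / R)"
  let ?F = "\<lambda>R x. \<rho> 0 * g x * ?s R x + (b 0 * \<rho> 0 - hderiv \<rho> 0) * f x * ?s R x
              - \<rho> 0 / b 0 * f x * (?s' R x / R)"
  let ?w = "\<lambda>x. \<rho> 0 * \<bar>g x\<bar> + \<bar>b 0 * \<rho> 0 - hderiv \<rho> 0\<bar> * \<bar>f x\<bar> + \<rho> 0 / b 0 * \<bar>f x\<bar> * M"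
  have pos: "0 < \<rho> 0" "0 < b 0" using \<rho>_pos b_pos by auto
  have fm: "f \<in> borel_measurable lebesgue" and gm: "g \<in> borel_measurable lebesgue"
    using f g by (auto intro: borel_measurable_integrable)
  have "((\<lambda>R. LINT x|lebesgue. ?F R x) \<longlongrightarrow>
      (LINT x|lebesgue. \<rho> 0 * g x + (b 0 * \<rho> 0 - hderiv \<rho> 0) * f x)) at_top"
  proof (rule integral_dominated_convergence_at_top[where w = ?w])
    show "?F R \<in> borel_measurable lebesgue" for R
      by (intro borel_measurable_diff borel_measurable_add borel_measurable_times
          borel_measurable_divide borel_measurable_const fm gm
          measurable_slice[OF measurable_\<psi>] measurable_slice[OF measurable_\<psi>'])
    show "(\<lambda>x. \<rho> 0 * g x + (b 0 * \<rho> 0 - hderiv \<rho> 0) * f x) \<in> borel_measurable lebesgue"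
      by (intro borel_measurable_add borel_measurable_times borel_measurable_const fm gm)
    show "integrable lebesgue ?w"
      by (intro Bochner_Integration.integrable_add integrable_mult_right integrable_mult_left
          integrable_abs f g)
    show "AE x in lebesgue. ((\<lambda>R. ?F R x) \<longlongrightarrow> \<rho> 0 * g x + (b 0 * \<rho> 0 - hderiv \<rho> 0) * f x) at_top"
    proof (rule AE_I2, rule tendsto_eventually)
      fix x :: "real ^ 'n"
      show "\<forall>\<^sub>F R in at_top. ?F R x = \<rho> 0 * g x + (b 0 * \<rho> 0 - hderiv \<rho> 0) * f x"
        using eventually_ge_at_top[of "2 * h (0, x)"]
      proof eventually_elim
        case (elim R)
        then have "h (0, x) / R \<le> 1 / 2" using h_ge_1[of "(0, x)"] by (simp add: divide_le_eq)
        then show ?case by (simp add: \<psi>_1 \<psi>'_0)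
      qed
    qed
    show "\<forall>\<^sub>F R in at_top. AE x in lebesgue. norm (?F R x) \<le> ?w x"
      using eventually_ge_at_top[of "1 :: real"]
    proof eventually_elim
      case (elim R)
      have "norm (?F R x) \<le> ?w x" for x :: "real ^ 'n"
      proof -
        have s: "\<bar>?s R x\<bar> \<le> 1" using \<psi>_nonneg \<psi>_le_1 by (simp add: abs_le_iff)
        have "\<bar>?s' R x / R\<bar> \<le> M / 1"
          unfolding abs_divide using M elim by (intro frac_le) auto
        then have s': "\<bar>?s' R x / R\<bar> \<le> M" by simp
        have "norm (?F R x) \<le> \<bar>\<rho> 0 * g x * ?s R x\<bar> + \<bar>(b 0 * \<rho> 0 - hderiv \<rho> 0) * f x * ?s R x\<bar>
            + \<bar>\<rho> 0 / b 0 * f x * (?s' R x / R)\<bar>"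
          unfolding real_norm_def by linarith
        also have "\<dots> \<le> \<rho> 0 * \<bar>g x\<bar> * 1 + \<bar>b 0 * \<rho> 0 - hderiv \<rho> 0\<bar> * \<bar>f x\<bar> * 1
            + \<rho> 0 / b 0 * \<bar>f x\<bar> * M"
          unfolding abs_mult[of "_ * g x"] abs_mult[of "_ * f x"]
          by (intro add_mono mult_mono s s') (use pos in \<open>auto simp: abs_mult\<close>)
        finally show ?thesis by simp
      qed
      then show ?case by simp
    qed
  qed
  also have "(LINT x|lebesgue. \<rho> 0 * g x + (b 0 * \<rho> 0 - hderiv \<rho> 0) * f x)
      = \<rho> 0 * (LINT x|lebesgue. g x) + (b 0 * \<rho> 0 - hderiv \<rho> 0) * (LINT x|lebesgue. f x)"
    using f g by simp
  also have "(\<lambda>R. LINT x|lebesgue. ?F R x) = (\<lambda>R. LINT x|lebesgue. g x * test_fn R (0, x)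
      + b 0 * f x * test_fn R (0, x) - f x * dt (test_fn R) (0, x))"
    by (intro ext Bochner_Integration.integral_cong)
      (simp_all add: dt_test_fn test_fn_def algebra_simps)
  finally show ?thesis .
qed

section \<open>The excess function and the \<rho>-mass of a region\<close>

abbreviation "\<Omega> \<equiv> Omega b m \<beta> T\<^sub>0"

lemma \<beta>_nonneg: "0 \<le> \<beta>"
  using balance by (simp add: mass_balance_def)

lemma excess_bdd: "0 \<le> L \<Longrightarrow> bdd_above (mass_excess_set b m \<beta> T\<^sub>0 L)"
  using balance by (simp add: mass_balance_def)

text \<open>Take t = r = \<open>T\<^sub>0\<close>: then \<open>Xfun\<close> is 1 and
  \<open>Qfun\<close> is 0. Nonemptiness is needed for comparing real suprema, and the element 0
  makes \<open>\<Omega>\<close> nonnegative.\<close>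

lemma zero_mem_excess: "0 \<le> L \<Longrightarrow> 0 \<in> mass_excess_set b m \<beta> T\<^sub>0 L"
proof -
  assume L: "0 \<le> L"
  have "1 + B T\<^sub>0 > 0" using B_nonneg[of T\<^sub>0] by linarith
  then have "Xfun b T\<^sub>0 T\<^sub>0 = 1" by (simp add: Xfun_def)
  then show ?thesis unfolding mass_excess_set_def using L
    by (intro CollectI exI[of _ T\<^sub>0]) (simp add: Qfun_def)
qed

lemma \<Omega>_nonneg: "0 \<le> L \<Longrightarrow> 0 \<le> \<Omega> L"
  unfolding Omega_def by (intro cSup_upper excess_bdd zero_mem_excess)

text \<open>Serves twice: it replaces \<Omega>(ln(1 + B(t))) by \<Omega>(ln R) on the region, and it
  makes the lifespan weight Borel measurable.\<close>

lemma \<Omega>_mono: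
  assumes "0 \<le> L" "L \<le> L'"
  shows "\<Omega> L \<le> \<Omega> L'"
  unfolding Omega_def
proof (rule cSup_subset_mono)
  show "mass_excess_set b m \<beta> T\<^sub>0 L \<noteq> {}" using zero_mem_excess[OF assms(1)] by blast
  show "bdd_above (mass_excess_set b m \<beta> T\<^sub>0 L')" using assms by (intro excess_bdd) simp
  show "mass_excess_set b m \<beta> T\<^sub>0 L \<subseteq> mass_excess_set b m \<beta> T\<^sub>0 L'"
    unfolding mass_excess_set_def using assms by (fastforce intro: order_trans)
qed

lemma measurable_region_\<rho>:
  "(\<lambda>z. indicator (region R) z * \<rho> (fst z) :: real) \<in> borel_measurable (borel :: (real \<times> (real ^ 'n::finite)) measure)"
proof -
  have "(\<lambda>z. indicator (region R :: (real \<times> (real ^ 'n)) set) z *\<^sub>R \<rho> (fst z)) \<in> borel_measurable borel"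
  proof (rule borel_measurable_continuous_on_indicator)
    show "region R \<in> sets (borel :: (real \<times> (real ^ 'n)) measure)"
      using closed_region by (rule borel_closed)
    show "continuous_on (region R) (\<lambda>z. \<rho> (fst z))"
      by (intro continuous_on_compose2[OF continuous_\<rho>] continuous_intros) (auto simp: region_def)
  qed
  then show ?thesis by simp
qed

text \<open>Three factors multiply: b \<rho> is at most a constant times R^\<beta> exp(\<Omega>(ln
  R)), the time integral of 1/b is B(\<tau>) \<le> R, and the ball of radius sqrt R has volume of
  order R^(n/2).\<close>

lemma region_mass:
  obtains K where "K > 0"
    "\<And>R. 1 \<le> R \<Longrightarrow>
      (\<integral>\<^sup>+z. ennreal (indicator (region R) z * \<rho> (fst z)) \<partial>(lebesgue :: (real \<times> (real ^ 'n::finite)) measure))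
      \<le> ennreal (K * (R powr (CARD('n) / 2 + \<beta> + 1) * exp (\<Omega> (ln R))))"
proof -
  obtain C where C: "C > 0" "\<And>t. 0 \<le> t \<Longrightarrow> b t * \<rho> t \<le> C * (1 + B t) powr \<beta> * exp (\<Omega> (ln (1 + B t)))"
    using \<rho>_bounds by metis
  define V where "V = unit_ball_vol (real CARD('n))"
  have V: "V > 0" by (simp add: V_def)
  have "(\<integral>\<^sup>+z. ennreal (indicator (region R) z * \<rho> (fst z)) \<partial>(lebesgue :: (real \<times> (real ^ 'n)) measure))
      \<le> ennreal (C * V * (R powr (CARD('n) / 2 + \<beta> + 1) * exp (\<Omega> (ln R))))" if R: "1 \<le> R" for R
  proof -
    obtain \<tau> where \<tau>: "0 \<le> \<tau>" "R = 1 + B \<tau>" using B_surj[OF R] by metis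
    define c where "c = C * R powr \<beta> * exp (\<Omega> (ln R))"
    have c: "0 \<le> c" using C by (simp add: c_def)
    let ?a = "\<lambda>t. ennreal (indicator {0..\<tau>} t * (1 / b t))"
    let ?k = "\<lambda>x :: real ^ 'n. indicator (cball 0 (sqrt R)) x :: ennreal"
    have am: "?a \<in> borel_measurable borel"
    proof -
      have "(\<lambda>t. indicator {0..\<tau>} t *\<^sub>R (1 / b t)) \<in> borel_measurable borel"
        by (intro borel_measurable_continuous_on_indicator continuous_on_subset[OF continuous_inverse_b]) auto
      then show ?thesis by simp
    qed
    have le: "ennreal (indicator (region R) z * \<rho> (fst z)) \<le> ennreal c * (?a (fst z) * ?k (snd z))"
      for z :: "real \<times> (real ^ 'n)"
    proof (cases "z \<in> region R")
      case True
      then have z: "0 \<le> fst z" "fst z \<le> \<tau>" "snd z \<in> cball 0 (sqrt R)"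
        using region_subset[OF \<tau>] by auto
      have BR: "1 + B (fst z) \<le> R" using B_mono[OF z(1,2)] \<tau> by simp
      have B1: "1 \<le> 1 + B (fst z)" using B_nonneg[of "fst z"] by simp
      have "b (fst z) * \<rho> (fst z) \<le> C * (1 + B (fst z)) powr \<beta> * exp (\<Omega> (ln (1 + B (fst z))))"
        by (rule C(2)[OF z(1)])
      also have "\<dots> \<le> c"
        unfolding c_def using BR B1 C(1) \<beta>_nonneg
        by (intro mult_mono powr_mono2 \<Omega>_mono iffD2[OF exp_le_cancel_iff] ln_mono) auto
      finally have "\<rho> (fst z) \<le> c * (1 / b (fst z))"
        using b_pos[OF z(1)] by (simp add: pos_le_divide_eq mult.commute)
      then have "ennreal (\<rho> (fst z)) \<le> ennreal (c * (1 / b (fst z)))" by (rule ennreal_leI)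
      also have "\<dots> = ennreal c * ennreal (1 / b (fst z))" by (rule ennreal_mult'[OF c])
      finally show ?thesis using True z by simp
    qed simp
    \<comment> \<open>The product structure is that of \<open>lborel\<close>, so the completion is
      removed before integrating in time and space separately.\<close>
    have "(\<integral>\<^sup>+z. ennreal (indicator (region R) z * \<rho> (fst z)) \<partial>(lebesgue :: (real \<times> (real ^ 'n)) measure))
      = (\<integral>\<^sup>+z. ennreal (indicator (region R) z * \<rho> (fst z)) \<partial>(lborel :: (real \<times> (real ^ 'n)) measure))"
      by (rule nn_integral_completion)
    also have "\<dots> \<le> (\<integral>\<^sup>+z. ennreal c * (?a (fst z) * ?k (snd z)) \<partial>(lborel :: (real \<times> (real ^ 'n)) measure))"
      by (intro nn_integral_mono le)
    also have "\<dots> = (\<integral>\<^sup>+z. ennreal c * (?a (fst z) * ?k (snd z)) \<partial>((lborel :: real measure) \<Otimes>\<^sub>M (lborel :: (real ^ 'n) measure)))"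
      by (simp add: lborel_prod)
    also have "\<dots> = (\<integral>\<^sup>+t. \<integral>\<^sup>+x. ennreal c * (?a t * ?k x) \<partial>lborel \<partial>lborel)"
    proof -
      have [measurable]: "?a \<in> borel_measurable lborel" using am by simp
      have [measurable]: "?k \<in> borel_measurable lborel"
        by (intro borel_measurable_indicator) (simp add: borel_closed)
      have "(\<lambda>z. ennreal c * (?a (fst z) * ?k (snd z))) \<in> borel_measurable (lborel \<Otimes>\<^sub>M lborel)"
        by measurable
      from lborel.nn_integral_fst[OF this] show ?thesis by simp
    qed
    also have "\<dots> = (\<integral>\<^sup>+t. ennreal c * emeasure lborel (cball (0 :: real ^ 'n) (sqrt R)) * ?a t \<partial>lborel)"
    proof (intro nn_integral_cong)
      fix t
      have "(\<integral>\<^sup>+x. (ennreal c * ?a t) * ?k x \<partial>lborel)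
          = (ennreal c * ?a t) * emeasure lborel (cball (0 :: real ^ 'n) (sqrt R))"
        by (rule nn_integral_cmult_indicator) (simp add: borel_closed)
      then show "(\<integral>\<^sup>+x. ennreal c * (?a t * ?k x) \<partial>lborel)
          = ennreal c * emeasure lborel (cball (0 :: real ^ 'n) (sqrt R)) * ?a t"
        unfolding mult.assoc by (simp only: mult.commute mult.left_commute)
    qed
    also have "\<dots> = ennreal c * emeasure lborel (cball (0 :: real ^ 'n) (sqrt R)) * (\<integral>\<^sup>+t. ?a t \<partial>lborel)"
      using am by (intro nn_integral_cmult) auto
    also have "(\<integral>\<^sup>+t. ?a t \<partial>lborel) = ennreal (B \<tau>)"
    proof (rule nn_integral_has_integral_lebesgue)
      show "((\<lambda>t. 1 / b t) has_integral B \<tau>) {0..\<tau>}"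
        unfolding Bfun_def
        by (intro integrable_integral integrable_continuous_interval continuous_on_subset[OF continuous_inverse_b]) auto
    qed (use b_pos in \<open>auto intro: less_imp_le\<close>)
    also have "emeasure lborel (cball (0 :: real ^ 'n) (sqrt R)) = ennreal (V * R powr (CARD('n) / 2))"
    proof -
      have "sqrt R ^ CARD('n) = R powr (CARD('n) / 2)"
        using R by (simp add: powr_half_sqrt[symmetric] powr_powr powr_realpow[symmetric])
      then show ?thesis using R by (simp add: emeasure_cball V_def)
    qed
    also have "ennreal c * ennreal (V * R powr (CARD('n) / 2)) * ennreal (B \<tau>)
        = ennreal (c * (V * R powr (CARD('n) / 2)) * B \<tau>)"
      using c V B_nonneg[of \<tau>] by (simp add: ennreal_mult')
    also have "\<dots> \<le> ennreal (c * (V * R powr (CARD('n) / 2)) * R)"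
      using c V \<tau> by (intro ennreal_leI mult_left_mono) auto
    also have "c * (V * R powr (CARD('n) / 2)) * R
        = C * V * (R powr (CARD('n) / 2 + \<beta> + 1) * exp (\<Omega> (ln R)))"
      using R by (simp add: c_def powr_add)
    finally show ?thesis .
  qed
  then show ?thesis using C(1) V by (intro that[of "C * V"]) auto
qed

end

section \<open>The energy inequality\<close>

text \<open>Below the threshold \<open>l powr (- 1 / (p - 1))\<close> the second term suffices;
  above it l a^(p-1) \<ge> 1, and the first term does. This is a version of Young's inequality with
  a free parameter.\<close>

lemma le_scaled_powr_plus:
  fixes a l p :: real
  assumes p: "p > 1" and a: "0 \<le> a" and l: "l > 0"
  shows "a \<le> l * a powr p + l powr (- 1 / (p - 1))"
proof (cases "a \<le> l powr (- 1 / (p - 1))")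
  case True
  then show ?thesis using l by (simp add: add_increasing)
next
  case False
  let ?q = "l powr (- 1 / (p - 1))"
  have q: "?q > 0" using l by simp
  then have a: "a > 0" using False by linarith
  have "l powr (- 1) = ?q powr (p - 1)" using p by (simp add: powr_powr)
  also have "\<dots> \<le> a powr (p - 1)" using False q p by (intro powr_mono2) auto
  finally have "1 \<le> l * a powr (p - 1)" using l by (simp add: powr_minus_divide pos_divide_le_eq mult.commute)
  then have "1 * a \<le> l * a powr (p - 1) * a" using a by (intro mult_right_mono) auto
  also have "\<dots> = l * a powr p" using a by (simp add: powr_diff)
  finally have "a \<le> l * a powr p" by simp
  then show ?thesis using q by linarith
qed

text \<open>Optimising \<open>l\<close> recovers Hoelder's inequality up to a constant, without a case distinction on \<open>y = 0\<close>.\<close>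

lemma powr_le_of_scaled_bounds:
  fixes F M K R y p :: real
  assumes p: "p > 1" and pos: "F > 0" "M > 0" "K > 0" "R > 0"
    and le: "\<And>l. l > 0 \<Longrightarrow> F \<le> K / R * (l * y + l powr (- 1 / (p - 1)) * M)"
  shows "F powr p \<le> (2 * K / R) powr p * M powr (p - 1) * y"
proof -
  have base: "x * x powr (p - 1) = x powr p" if "x > 0" for x :: real
    using powr_mult_base[of x "p - 1"] that by simp
  \<comment> \<open>Chosen so that the term with \<open>M\<close> equals F/2 and can be absorbed on
    the left.\<close>
  define q where "q = 2 * K / R * M / F"
  have q: "q > 0" using pos by (simp add: q_def)
  define l where "l = q powr (p - 1)"
  have "l powr (- 1 / (p - 1)) = q powr (- 1)" using p by (simp add: l_def powr_powr)
  then have "l powr (- 1 / (p - 1)) = 1 / q" using q by (simp add: powr_minus_divide)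
  moreover have "l > 0" using q by (simp add: l_def)
  ultimately have "F \<le> K / R * (l * y + 1 / q * M)" using le by metis
  moreover have "K / R * (1 / q * M) = F / 2" using pos by (simp add: q_def)
  moreover have "K / R * (l * y + 1 / q * M) = K / R * (l * y) + K / R * (1 / q * M)"
    by (rule distrib_left)
  moreover have "2 * K / R * y * l = 2 * (K / R * (l * y))" by simp
  ultimately have "F \<le> 2 * K / R * y * l" by linarith
  then have "F * F powr (p - 1) \<le> 2 * K / R * y * l * F powr (p - 1)"
    by (intro mult_right_mono) auto
  also have "l * F powr (p - 1) = (q * F) powr (p - 1)"
    using q pos by (simp add: l_def powr_mult)
  then have "2 * K / R * y * l * F powr (p - 1) = 2 * K / R * y * (q * F) powr (p - 1)"
    by (simp add: mult.assoc)
  also have "q * F = (2 * K / R) * M" using pos by (simp add: q_def)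
  also have "((2 * K / R) * M) powr (p - 1) = (2 * K / R) powr (p - 1) * M powr (p - 1)"
    using pos by (intro powr_mult)
  also have "2 * K / R * y * ((2 * K / R) powr (p - 1) * M powr (p - 1))
      = (2 * K / R * (2 * K / R) powr (p - 1)) * M powr (p - 1) * y" by (simp only: mult_ac)
  also have "2 * K / R * (2 * K / R) powr (p - 1) = (2 * K / R) powr p"
    using pos by (intro base) simp
  also have "F * F powr (p - 1) = F powr p" using pos by (intro base) simp
  finally show ?thesis .
qed

context test_family
begin

text \<open>Integrability of |u|^p is available only on compact sets; hence the indicator. In the
  estimates the cut stays at the radius 1 + B(\<tau>) while the radius inside \<psi> varies, so the
  density itself is not differentiated.\<close>

definition dens :: "(real \<times> (real ^ 'n::finite) \<Rightarrow> real) \<Rightarrow> real \<Rightarrow> real \<times> (real ^ 'n) \<Rightarrow> real" where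
  "dens u R z = indicator (region R) z * (\<bar>u z\<bar> powr p * \<rho> (fst z))"

lemma dens_nonneg: "0 \<le> dens u R z"
  using \<rho>_pos[of "fst z"] by (auto simp: dens_def region_def indicator_def intro: less_imp_le)

lemma integrable_dens:
  fixes u :: "real \<times> (real ^ 'n::finite) \<Rightarrow> real"
  assumes u: "Lp_loc p (cyl T) u" and R: "1 \<le> R" "region R \<subseteq> (cyl T :: (real \<times> (real ^ 'n)) set)"
  shows "integrable lebesgue (dens u R)"
proof -
  let ?v = "\<lambda>z. indicator (region R) z *\<^sub>R \<bar>u z\<bar> powr p"
  have v: "integrable lebesgue ?v"
    using u compact_region[OF R(1)] R(2) by (auto simp: Lp_loc_def set_integrable_def)
  have "compact ((\<lambda>z. \<rho> (fst z)) ` (region R :: (real \<times> (real ^ 'n)) set))"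
    by (intro compact_continuous_image compact_region R continuous_on_compose2[OF continuous_\<rho>]
        continuous_intros) (auto simp: region_def)
  then have "bounded ((\<lambda>z. \<rho> (fst z)) ` (region R :: (real \<times> (real ^ 'n)) set))"
    by (rule compact_imp_bounded)
  then obtain M where "\<forall>y\<in>(\<lambda>z. \<rho> (fst z)) ` (region R :: (real \<times> (real ^ 'n)) set). norm y \<le> M"
    unfolding bounded_iff by blast
  then have M: "\<bar>\<rho> (fst z)\<bar> \<le> M" if "z \<in> region R" for z :: "real \<times> (real ^ 'n)"
    using that by simp
  show ?thesis
  proof (rule Bochner_Integration.integrable_bound)
    show "integrable lebesgue (\<lambda>z. M * ?v z)" using v by (rule integrable_mult_right)
    have "(\<lambda>z. ?v z * (indicator (region R) z * \<rho> (fst z))) \<in> borel_measurable lebesgue"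
      by (rule borel_measurable_times[OF borel_measurable_integrable[OF v] measurable_completion])
        (simp add: measurable_region_\<rho>)
    also have "(\<lambda>z. ?v z * (indicator (region R) z * \<rho> (fst z))) = dens u R"
      by (auto simp: dens_def indicator_def)
    finally show "dens u R \<in> borel_measurable lebesgue" .
    show "AE z in lebesgue. norm (dens u R z) \<le> norm (M * ?v z)"
    proof (rule AE_I2)
      fix z :: "real \<times> (real ^ 'n)"
      show "norm (dens u R z) \<le> norm (M * ?v z)"
      proof (cases "z \<in> region R")
        case True
        then have "\<bar>\<rho> (fst z)\<bar> \<le> \<bar>M\<bar>" using M[OF True] by linarith
        then show ?thesis using True by (simp add: dens_def abs_mult mult.commute mult_right_mono)
      qed (simp add: dens_def)
    qed
  qed
qed

lemma integrable_dens_mult: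
  fixes u :: "real \<times> (real ^ 'n::finite) \<Rightarrow> real"
  assumes v: "integrable lebesgue (dens u R)" and F: "F \<in> borel_measurable borel"
    and M: "\<And>z. \<bar>F z\<bar> \<le> M"
  shows "integrable lebesgue (\<lambda>z. dens u R z * F z)"
proof (rule Bochner_Integration.integrable_bound)
  show "integrable lebesgue (\<lambda>z. M * dens u R z)" using v by (rule integrable_mult_right)
  show "(\<lambda>z. dens u R z * F z) \<in> borel_measurable lebesgue"
    by (intro borel_measurable_times borel_measurable_integrable[OF v] measurable_completion)
      (simp add: F)
  show "AE z in lebesgue. norm (dens u R z * F z) \<le> norm (M * dens u R z)"
  proof (rule AE_I2)
    fix z
    have "\<bar>F z\<bar> \<le> \<bar>M\<bar>" using M[of z] by linarith
    then show "norm (dens u R z * F z) \<le> norm (M * dens u R z)"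
      by (simp add: abs_mult mult.commute mult_right_mono)
  qed
qed

text \<open>Young's inequality is applied to a = |u| (-\<psi>')^(1/p), whose p-th power is |u|^p
  (-\<psi>'), with weight \<rho>. The constant is that of \<open>adj_bound\<close>, so it is chosen
  before the data, the solution, the radius and the free parameter \<open>l\<close>.\<close>

lemma weak_energy_inequality:
  obtains K where "K > 0"
    "\<And>\<epsilon> f g T \<tau> R (l :: real) (u :: real \<times> (real ^ 'n::finite) \<Rightarrow> real).
      \<lbrakk>weak_solution b m p \<epsilon> f g T u; 0 \<le> \<tau>; ereal \<tau> < T; 1 \<le> R; R \<le> 1 + B \<tau>; l > 0\<rbrakk> \<Longrightarrow>
      (LINT z|lebesgue. dens u (1 + B \<tau>) z * \<psi> (h z / R))
      + \<epsilon> * (LINT x|lebesgue. g x * test_fn R (0, x) + b 0 * f x * test_fn R (0, x)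
                - f x * dt (test_fn R) (0, x))
      \<le> K / R * (l * (LINT z|lebesgue. dens u (1 + B \<tau>) z * - \<psi>' (h z / R))
          + l powr (- 1 / (p - 1)) *
            (LINT z|lebesgue. indicator (region R) (z :: real \<times> (real ^ 'n)) * \<rho> (fst z)))"
proof -
  obtain K where K: "K > 0"
    "\<And>z :: real \<times> (real ^ 'n). \<And>R. 0 \<le> fst z \<Longrightarrow> 1 \<le> R \<Longrightarrow>
       \<bar>adj R z\<bar> \<le> K * \<rho> (fst z) / R * ((- \<psi>' (h z / R)) powr (1 / p) * indicator (region R) z)"
    using adj_bound by blast
  obtain M where M: "M > 0" "\<And>s. \<bar>\<psi>' s\<bar> \<le> M" using \<psi>'_bounded by blast
  obtain C where C: "C > 0" "\<And>R. 1 \<le> R \<Longrightarrow>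
      (\<integral>\<^sup>+z. ennreal (indicator (region R) z * \<rho> (fst z)) \<partial>(lebesgue :: (real \<times> (real ^ 'n)) measure))
      \<le> ennreal (C * (R powr (CARD('n) / 2 + \<beta> + 1) * exp (\<Omega> (ln R))))"
    using region_mass by blast
  show ?thesis
  proof (rule that[OF K(1)])
    fix \<epsilon> f g T \<tau> R and l :: real and u :: "real \<times> (real ^ 'n) \<Rightarrow> real"
    assume weak: "weak_solution b m p \<epsilon> f g T u" and \<tau>: "0 \<le> \<tau>" "ereal \<tau> < T"
      and R: "1 \<le> R" "R \<le> 1 + B \<tau>" and l: "l > 0"
    let ?R1 = "1 + B \<tau>"
    \<comment> \<open>The terminal time of \<open>region R\<close>. It is at most
      \<open>\<tau>\<close>, so the test function of radius \<open>R\<close> is admissible before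
      \<open>T\<close>.\<close>
    obtain \<sigma> where \<sigma>: "0 \<le> \<sigma>" "1 + B \<sigma> = R" using B_surj[OF R(1)] by metis
    have "\<sigma> \<le> \<tau>"
    proof (rule ccontr)
      assume "\<not> \<sigma> \<le> \<tau>"
      then have "B \<tau> < B \<sigma>" using \<tau>(1) by (intro B_strict_mono) auto
      then show False using \<sigma> R by simp
    qed
    then have \<sigma>T: "ereal \<sigma> < T" using \<tau>(2) by (meson ereal_less_eq(3) le_less_trans)
    have R1: "1 \<le> ?R1" using R by simp
    have sub: "region ?R1 \<subseteq> (cyl T :: (real \<times> (real ^ 'n)) set)"
      using \<tau> by (intro region_subset_cyl) auto
    have mono: "region R \<subseteq> (region ?R1 :: (real \<times> (real ^ 'n)) set)" using R by (auto simp: region_def)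
    have v: "integrable lebesgue (dens u ?R1)"
      using weak by (intro integrable_dens[OF _ R1 sub]) (simp add: weak_solution_def)
    have int\<rho>: "integrable lebesgue (\<lambda>z :: real \<times> (real ^ 'n). indicator (region R) z * \<rho> (fst z))"
    proof (rule integrableI_nonneg)
      show "(\<lambda>z :: real \<times> (real ^ 'n). indicator (region R) z * \<rho> (fst z)) \<in> borel_measurable lebesgue"
        by (intro measurable_completion) (simp add: measurable_region_\<rho>)
      show "AE z :: real \<times> (real ^ 'n) in lebesgue. 0 \<le> indicator (region R) z * \<rho> (fst z)"
        using \<rho>_pos by (intro AE_I2) (auto simp: indicator_def region_def intro: less_imp_le)
      show "(\<integral>\<^sup>+z. ennreal (indicator (region R) z * \<rho> (fst z)) \<partial>(lebesgue :: (real \<times> (real ^ 'n)) measure)) < \<infinity>"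
        using C(2)[OF R(1)] by (rule le_less_trans) simp
    qed
    have int\<psi>': "integrable lebesgue (\<lambda>z. dens u ?R1 z * - \<psi>' (h z / R))"
      by (rule integrable_dens_mult[OF v, where M = M])
        (simp_all add: M measurable_\<psi>' borel_measurable_uminus)
    have tf: "test_function T (test_fn R :: real \<times> (real ^ 'n) \<Rightarrow> real)"
      by (rule test_function_test_fn[OF \<sigma>(1) _ \<sigma>T]) (simp add: \<sigma>)
    let ?J = "LINT x|lebesgue. g x * test_fn R (0, x) + b 0 * f x * test_fn R (0, x)
                - f x * dt (test_fn R) (0, x)"
    have eq: "(LINT z:cyl T|lebesgue. \<bar>u z\<bar> powr p * test_fn R z) + \<epsilon> * ?J
        = (LINT z:cyl T|lebesgue. u z * adj R z)"
      using weak tf unfolding weak_solution_def adj_def by blast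
    \<comment> \<open>Since \<psi>(h/R) vanishes for h \<ge> R, cutting at the larger radius 1 +
      B(\<tau>) changes nothing.\<close>
    have "(LINT z:cyl T|lebesgue. \<bar>u z\<bar> powr p * test_fn R z)
        = (LINT z|lebesgue. dens u ?R1 z * \<psi> (h z / R))"
      unfolding set_lebesgue_integral_def
    proof (rule Bochner_Integration.integral_cong)
      fix z :: "real \<times> (real ^ 'n)"
      show "indicator (cyl T) z *\<^sub>R (\<bar>u z\<bar> powr p * test_fn R z) = dens u ?R1 z * \<psi> (h z / R)"
      proof (cases "z \<in> region R")
        case True
        then have "z \<in> region ?R1" "z \<in> cyl T" using mono sub by auto
        then show ?thesis by (simp add: dens_def test_fn_def)
      next
        case False
        then have "test_fn R z = 0" if "z \<in> cyl T"
          using that R by (intro test_fn_eq_0) (auto simp: cyl_def)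
        moreover have "\<psi> (h z / R) = 0" if "z \<in> region ?R1"
          using that False R by (intro \<psi>_0) (auto simp: region_def)
        ultimately show ?thesis by (auto simp: dens_def indicator_def)
      qed
    qed simp
    moreover have "(LINT z:cyl T|lebesgue. u z * adj R z)
      \<le> (LINT z|lebesgue. K / R * (l * (dens u ?R1 z * - \<psi>' (h z / R))
          + l powr (- 1 / (p - 1)) * (indicator (region R) z * \<rho> (fst z))))"
      unfolding set_lebesgue_integral_def
    \<comment> \<open>Only the majorant has to be integrable and nonnegative: if the left integrand
      is not integrable, its integral is 0 by convention.\<close>
    proof (rule integral_mono')
      show "integrable lebesgue (\<lambda>z. K / R * (l * (dens u ?R1 z * - \<psi>' (h z / R))
          + l powr (- 1 / (p - 1)) * (indicator (region R) z * \<rho> (fst z))))"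
        by (intro integrable_mult_right Bochner_Integration.integrable_add int\<psi>' int\<rho>)
    next
      fix z :: "real \<times> (real ^ 'n)"
      let ?G = "K / R * (l * (dens u ?R1 z * - \<psi>' (h z / R))
          + l powr (- 1 / (p - 1)) * (indicator (region R) z * \<rho> (fst z)))"
      have "0 \<le> indicator (region R) z * \<rho> (fst z)"
        using \<rho>_pos[of "fst z"] by (auto simp: indicator_def region_def intro: less_imp_le)
      then have G1: "0 \<le> l powr (- 1 / (p - 1)) * (indicator (region R) z * \<rho> (fst z))" by simp
      have "0 \<le> dens u ?R1 z * - \<psi>' (h z / R)"
        using dens_nonneg[of u ?R1 z] \<psi>'_nonpos[of "h z / R"] by (intro mult_nonneg_nonneg) auto
      then have G2: "0 \<le> l * (dens u ?R1 z * - \<psi>' (h z / R))" by (rule mult_nonneg_nonneg[OF less_imp_le[OF l]])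
      have G3: "0 \<le> K / R" using K(1) R(1) by simp
      show G: "0 \<le> ?G" by (rule mult_nonneg_nonneg[OF G3 add_nonneg_nonneg[OF G2 G1]])
      show "indicator (cyl T) z *\<^sub>R (u z * adj R z) \<le> ?G"
      proof (cases "z \<in> region R")
        case True
        then have z: "z \<in> region ?R1" "z \<in> cyl T" "0 \<le> fst z"
          using mono sub by (auto simp: region_def)
        define X where "X = (- \<psi>' (h z / R)) powr (1 / p)"
        have X: "0 \<le> X" by (simp add: X_def)
        have Xp: "X powr p = - \<psi>' (h z / R)"
          using p \<psi>'_nonpos[of "h z / R"] by (simp add: X_def powr_powr)
        have "\<bar>adj R z\<bar> \<le> K * \<rho> (fst z) / R * X"
          using K(2)[OF z(3) R(1)] True by (simp add: X_def)
        then have "\<bar>u z\<bar> * \<bar>adj R z\<bar> \<le> \<bar>u z\<bar> * (K * \<rho> (fst z) / R * X)"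
          by (intro mult_left_mono) auto
        then have "u z * adj R z \<le> \<bar>u z\<bar> * (K * \<rho> (fst z) / R * X)"
          using abs_ge_self[of "u z * adj R z"] by (simp only: abs_mult)
        also have "\<dots> = K / R * \<rho> (fst z) * (\<bar>u z\<bar> * X)" by simp
        also have "\<dots> \<le> K / R * \<rho> (fst z) * (l * (\<bar>u z\<bar> * X) powr p + l powr (- 1 / (p - 1)))"
          using K(1) R(1) \<rho>_pos[OF z(3)] X
          by (intro mult_left_mono le_scaled_powr_plus p l mult_nonneg_nonneg) auto
        also have "(\<bar>u z\<bar> * X) powr p = \<bar>u z\<bar> powr p * - \<psi>' (h z / R)"
          using X by (simp add: powr_mult Xp)
        also have "K / R * \<rho> (fst z) * (l * (\<bar>u z\<bar> powr p * - \<psi>' (h z / R)) + l powr (- 1 / (p - 1))) = ?G"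
          using True z by (simp add: dens_def algebra_simps)
        finally show ?thesis using z by simp
      next
        case False
        have "indicator (cyl T) z *\<^sub>R (u z * adj R z) = 0"
        proof (cases "z \<in> cyl T")
          case True
          then show ?thesis using K(2)[of z R] R(1) False by (simp add: cyl_def)
        qed simp
        then show ?thesis using G by (simp only:)
      qed
    qed
    moreover have "(LINT z|lebesgue. K / R * (l * (dens u ?R1 z * - \<psi>' (h z / R))
          + l powr (- 1 / (p - 1)) * (indicator (region R) z * \<rho> (fst z))))
      = K / R * (l * (LINT z|lebesgue. dens u ?R1 z * - \<psi>' (h z / R))
          + l powr (- 1 / (p - 1)) * (LINT z|lebesgue. indicator (region R) (z :: real \<times> (real ^ 'n)) * \<rho> (fst z)))"
      using Bochner_Integration.integral_add[OF integrable_mult_right[OF int\<psi>', of l]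
          integrable_mult_right[OF int\<rho>, of "l powr (- 1 / (p - 1))"]]
      by (simp only: integral_mult_right_zero)
    ultimately show "(LINT z|lebesgue. dens u (1 + B \<tau>) z * \<psi> (h z / R)) + \<epsilon> * ?J
      \<le> K / R * (l * (LINT z|lebesgue. dens u (1 + B \<tau>) z * - \<psi>' (h z / R))
          + l powr (- 1 / (p - 1)) *
            (LINT z|lebesgue. indicator (region R) (z :: real \<times> (real ^ 'n)) * \<rho> (fst z)))"
      using eq by linarith
  qed
qed

end

section \<open>The lifespan bound\<close>

text \<open>Continuity from below of the measure with density \<open>f\<close>. It extends the bound
  to the unbounded range of a global solution and, for finite T, up to the radius 1 + B(T).\<close>

lemma nn_integral_UN_Icc_le:
  fixes f :: "real \<Rightarrow> ennreal" and c :: "nat \<Rightarrow> real"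
  assumes f: "f \<in> borel_measurable borel" and c: "incseq c"
    and le: "\<And>k. (\<integral>\<^sup>+x\<in>{a..c k}. f x \<partial>lborel) \<le> L"
  shows "(\<integral>\<^sup>+x\<in>(\<Union>k. {a..c k}). f x \<partial>lborel) \<le> L"
proof -
  have inc: "incseq (\<lambda>k. {a..c k})" using c by (auto simp: incseq_def intro: order_trans)
  have f': "f \<in> borel_measurable lborel" using f by simp
  have "(\<integral>\<^sup>+x\<in>(\<Union>k. {a..c k}). f x \<partial>lborel) = emeasure (density lborel f) (\<Union>k. {a..c k})"
    by (rule emeasure_density[OF f', symmetric]) auto
  also have "\<dots> = (SUP k. emeasure (density lborel f) {a..c k})"
    by (rule SUP_emeasure_incseq[OF _ inc, symmetric]) auto
  also have "\<dots> \<le> L"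
    by (rule SUP_least) (simp add: emeasure_density[OF f'] le)
  finally show ?thesis .
qed

context test_family
begin

lemma lifespan_weight_nonneg: "0 \<le> lifespan_weight b m \<beta> T\<^sub>0 p \<theta> R"
  by (simp add: lifespan_weight_def)

text \<open>The indicator removes radii below 1, where \<open>ln R\<close> may leave the range on
  which \<open>\<Omega>\<close> is known to be monotone; with \<open>max 1 R\<close> the composition
  is monotone on the whole line.\<close>

lemma measurable_lifespan_weight:
  "(\<lambda>R. indicator {1..} R * lifespan_weight b m \<beta> T\<^sub>0 p \<theta> R) \<in> borel_measurable borel"
proof -
  have "mono (\<lambda>R. \<Omega> (ln (max 1 R)))"
    by (intro monoI \<Omega>_mono) (auto intro: ln_mono)
  then have [measurable]: "(\<lambda>R. \<Omega> (ln (max 1 R))) \<in> borel_measurable borel"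
    by (rule borel_measurable_mono)
  have "(\<lambda>R. indicator {1..} R * (R powr (- 1 + (p - 1) * \<theta>) * exp (- (p - 1) * \<Omega> (ln (max 1 R)))))
      \<in> borel_measurable borel" by measurable
  also have "(\<lambda>R. indicator {1..} R * (R powr (- 1 + (p - 1) * \<theta>) * exp (- (p - 1) * \<Omega> (ln (max 1 R)))))
      = (\<lambda>R. indicator {1..} R * lifespan_weight b m \<beta> T\<^sub>0 p \<theta> R)"
    by (auto simp: lifespan_weight_def indicator_def max_def)
  finally show ?thesis .
qed

text \<open>With s = h/r the derivative of \<psi>(h/r) in r is -s \<psi>'(s)/r. Its size is
  therefore controlled uniformly although h is unbounded.\<close>

lemma \<psi>'_mult_bounded:
  obtains M where "M > 0" "\<And>s. \<bar>\<psi>' s * s\<bar> \<le> M"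
proof -
  obtain M where M: "M > 0" "\<And>s. \<bar>\<psi>' s\<bar> \<le> M" using \<psi>'_bounded by blast
  have "\<bar>\<psi>' s * s\<bar> \<le> M" for s
  proof (cases "1 / 2 < s \<and> s < 1")
    case True
    then have "\<bar>\<psi>' s\<bar> * \<bar>s\<bar> \<le> M * 1" using M by (intro mult_mono) auto
    then show ?thesis by (simp add: abs_mult)
  next
    case False
    then have "\<psi>' s = 0" by (intro \<psi>'_0) auto
    then show ?thesis using M(1) by simp
  qed
  then show ?thesis using M(1) that by blast
qed

section \<open>Differentiation of the energy with respect to the radius\<close>

text \<open>The argument concerns any integrable \<open>v\<close> and measurable \<open>h\<close> on
  any measure space; the \<open>h\<close> fixed here shadows the parabolic variable.\<close>

context
  fixes v h :: "'a \<Rightarrow> real" and M :: "'a measure"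
  assumes v: "integrable M v" and h: "h \<in> borel_measurable M"
begin

lemma measurable_energy_integrand: "(\<lambda>z. v z * \<psi> (h z / r)) \<in> borel_measurable M"
  by (intro borel_measurable_times borel_measurable_integrable[OF v]
      measurable_compose[OF _ borel_measurable_continuous_onI[OF continuous_\<psi>]]
      borel_measurable_divide h borel_measurable_const)

lemma measurable_energy_deriv_integrand:
  "(\<lambda>z. v z * (\<psi>' (h z / r) * - (h z / r\<^sup>2))) \<in> borel_measurable M"
  by (intro borel_measurable_times borel_measurable_integrable[OF v] borel_measurable_uminus
      measurable_compose[OF _ borel_measurable_continuous_onI[OF continuous_\<psi>']]
      borel_measurable_divide h borel_measurable_const)

lemma energy_deriv_integrand_bound:
  assumes K: "\<And>s. \<bar>\<psi>' s * s\<bar> \<le> K" and a: "0 < a" "a \<le> r"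
  shows "\<bar>v z * (\<psi>' (h z / r) * - (h z / r\<^sup>2))\<bar> \<le> \<bar>v z\<bar> * (K / a)"
proof -
  have "0 \<le> K" using K[of 0] by simp
  have "\<bar>\<psi>' (h z / r) * - (h z / r\<^sup>2)\<bar> = \<bar>\<psi>' (h z / r) * (h z / r)\<bar> / r"
    using a by (simp add: abs_mult power2_eq_square)
  also have "\<dots> \<le> K / a" using a \<open>0 \<le> K\<close> by (intro frac_le K) auto
  finally show ?thesis unfolding abs_mult[of "v z"] by (intro mult_left_mono) auto
qed

lemma integrable_energy_deriv:
  assumes "0 < r"
  shows "integrable M (\<lambda>z. v z * (\<psi>' (h z / r) * - (h z / r\<^sup>2)))"
proof -
  obtain K where K: "\<And>s. \<bar>\<psi>' s * s\<bar> \<le> K" using \<psi>'_mult_bounded by blast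
  show ?thesis
  proof (rule Bochner_Integration.integrable_bound)
    show "integrable M (\<lambda>z. \<bar>v z\<bar> * (K / r))" using v by simp
    show "AE z in M. norm (v z * (\<psi>' (h z / r) * - (h z / r\<^sup>2))) \<le> norm (\<bar>v z\<bar> * (K / r))"
      using energy_deriv_integrand_bound[OF K assms order_refl]
      by (intro AE_I2) (metis abs_ge_self order_trans real_norm_def)
  qed (rule measurable_energy_deriv_integrand)
qed

lemma energy_deriv:
  assumes r: "0 < r"
  shows "((\<lambda>r. \<integral>z. v z * \<psi> (h z / r) \<partial>M) has_real_derivative
      (\<integral>z. v z * (\<psi>' (h z / r) * - (h z / r\<^sup>2)) \<partial>M)) (at r)"
proof -
  obtain K where K: "\<And>s. \<bar>\<psi>' s * s\<bar> \<le> K" using \<psi>'_mult_bounded by blast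
  show ?thesis
  \<comment> \<open>The set of radii above r/2 stays away from 0, so 1/q \<le> 2/r gives one
    dominating function for all of them.\<close>
  proof (rule has_real_derivative_lebesgue_integral[where U = "{r / 2<..}" and w = "\<lambda>z. \<bar>v z\<bar> * (K / (r / 2))"])
    show "integrable M (\<lambda>z. \<bar>v z\<bar> * (K / (r / 2)))" using v by simp
    fix q assume q: "q \<in> {r / 2<..}"
    show "integrable M (\<lambda>z. v z * \<psi> (h z / q))"
      by (rule Bochner_Integration.integrable_bound[OF v measurable_energy_integrand])
        (simp add: abs_mult \<psi>_nonneg \<psi>_le_1 mult_left_le)
    show "(\<lambda>z. v z * (\<psi>' (h z / q) * - (h z / q\<^sup>2))) \<in> borel_measurable M"
      by (rule measurable_energy_deriv_integrand)
    show "\<bar>v z * (\<psi>' (h z / q) * - (h z / q\<^sup>2))\<bar> \<le> \<bar>v z\<bar> * (K / (r / 2))" for z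
      using q r by (intro energy_deriv_integrand_bound K) auto
    show "((\<lambda>q. v z * \<psi> (h z / q)) has_real_derivative v z * (\<psi>' (h z / q) * - (h z / q\<^sup>2))) (at q)" for z
    proof (rule DERIV_cmult, rule DERIV_chain2[OF \<psi>_deriv])
      show "((\<lambda>q. h z / q) has_real_derivative - (h z / q\<^sup>2)) (at q)"
        using DERIV_divide[OF DERIV_const DERIV_ident, of q "h z"] q r by (simp add: power2_eq_square)
    qed
  qed (use r in auto)
qed

text \<open>Needed for the measurability of the majorant in the integrated differential inequality;
  dominated convergence applies because the radii are at least \<open>a\<close>.\<close>

lemma continuous_energy_deriv:
  assumes a: "0 < a"
  shows "continuous_on {a..c} (\<lambda>r. \<integral>z. v z * (\<psi>' (h z / r) * - (h z / r\<^sup>2)) \<partial>M)"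
  unfolding continuous_on_sequentially comp_def
proof (intro allI ballI impI, elim conjE)
  obtain K where K: "\<And>s. \<bar>\<psi>' s * s\<bar> \<le> K" using \<psi>'_mult_bounded by blast
  fix X r assume X: "\<forall>n. X n \<in> {a..c}" "X \<longlonglongrightarrow> r" and r: "r \<in> {a..c}"
  show "(\<lambda>n. \<integral>z. v z * (\<psi>' (h z / X n) * - (h z / (X n)\<^sup>2)) \<partial>M)
      \<longlonglongrightarrow> (\<integral>z. v z * (\<psi>' (h z / r) * - (h z / r\<^sup>2)) \<partial>M)"
  proof (rule integral_dominated_convergence[where w = "\<lambda>z. \<bar>v z\<bar> * (K / a)"])
    show "integrable M (\<lambda>z. \<bar>v z\<bar> * (K / a))" using v by simp
    show "AE z in M. norm (v z * (\<psi>' (h z / X n) * - (h z / (X n)\<^sup>2))) \<le> \<bar>v z\<bar> * (K / a)" for n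
      unfolding real_norm_def using X a by (intro AE_I2 energy_deriv_integrand_bound K) auto
    show "AE z in M. (\<lambda>n. v z * (\<psi>' (h z / X n) * - (h z / (X n)\<^sup>2)))
        \<longlonglongrightarrow> v z * (\<psi>' (h z / r) * - (h z / r\<^sup>2))"
    proof (rule AE_I2)
      fix z
      have \<psi>'_at: "isCont \<psi>' s" for s by (rule DERIV_isCont[OF \<psi>'_deriv])
      show "(\<lambda>n. v z * (\<psi>' (h z / X n) * - (h z / (X n)\<^sup>2)))
        \<longlonglongrightarrow> v z * (\<psi>' (h z / r) * - (h z / r\<^sup>2))"
        by (intro tendsto_intros isCont_tendsto_compose[OF \<psi>'_at] X) (use r a in auto)
    qed
  qed (rule measurable_energy_deriv_integrand)+
qed

end

text \<open>Only times before \<open>T\<close> are covered, as the supports of the test functions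
  require. The radius comes from the data term alone and the constant from the test family alone, so
  neither depends on \<epsilon>, T, \<tau> or u.\<close>

lemma lifespan_integral_bound:
  fixes f g :: "real ^ 'n::finite \<Rightarrow> real"
  assumes f: "integrable lebesgue f" and g: "integrable lebesgue g"
    and J: "J\<^sub>0 = \<rho> 0 * (LINT x|lebesgue. g x) + (b 0 * \<rho> 0 - hderiv \<rho> 0) * (LINT x|lebesgue. f x)"
    and J_pos: "J\<^sub>0 > 0" and \<theta>: "\<theta> = 1 / (p - 1) - real CARD('n) / 2 - \<beta>"
  obtains R\<^sub>0 C where "R\<^sub>0 \<ge> 2" "C > 0"
    "\<And>\<epsilon> T \<tau> u. \<lbrakk>\<epsilon> > 0; weak_solution b m p \<epsilon> f g T u; 0 \<le> \<tau>; ereal \<tau> < T; R\<^sub>0 \<le> 1 + B \<tau>\<rbrakk> \<Longrightarrow>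
      (\<integral>\<^sup>+R\<in>{R\<^sub>0..1 + B \<tau>}. ennreal (lifespan_weight b m \<beta> T\<^sub>0 p \<theta> R) \<partial>lborel)
      \<le> ennreal (C * (\<epsilon> * J\<^sub>0) powr (- (p - 1)))"
proof -
  let ?J = "\<lambda>R. LINT x|lebesgue. g x * test_fn R (0, x) + b 0 * f x * test_fn R (0, x)
              - f x * dt (test_fn R) (0, x)"
  have "(?J \<longlongrightarrow> J\<^sub>0) at_top" unfolding J by (rule data_term_tendsto[OF f g])
  then have "\<forall>\<^sub>F R in at_top. J\<^sub>0 / 2 < ?J R"
    using J_pos by (intro order_tendstoD(1)) auto
  then obtain N where N: "\<And>R. N \<le> R \<Longrightarrow> J\<^sub>0 / 2 < ?J R"
    unfolding eventually_at_top_linorder by blast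
  \<comment> \<open>Beyond \<open>N\<close> the data term exceeds half of its limit.\<close>
  define R\<^sub>0 where "R\<^sub>0 = max 2 N"
  have R\<^sub>0: "2 \<le> R\<^sub>0" "N \<le> R\<^sub>0" by (auto simp: R\<^sub>0_def)
  obtain K where K: "K > 0"
    "\<And>\<epsilon> f g T \<tau> R (l :: real) (u :: real \<times> (real ^ 'n) \<Rightarrow> real).
      \<lbrakk>weak_solution b m p \<epsilon> f g T u; 0 \<le> \<tau>; ereal \<tau> < T; 1 \<le> R; R \<le> 1 + B \<tau>; l > 0\<rbrakk> \<Longrightarrow>
      (LINT z|lebesgue. dens u (1 + B \<tau>) z * \<psi> (h z / R))
      + \<epsilon> * (LINT x|lebesgue. g x * test_fn R (0, x) + b 0 * f x * test_fn R (0, x)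
                - f x * dt (test_fn R) (0, x))
      \<le> K / R * (l * (LINT z|lebesgue. dens u (1 + B \<tau>) z * - \<psi>' (h z / R))
          + l powr (- 1 / (p - 1)) *
            (LINT z|lebesgue. indicator (region R) (z :: real \<times> (real ^ 'n)) * \<rho> (fst z)))"
    by (rule weak_energy_inequality) blast
  obtain D where D: "D > 0" "\<And>R. 1 \<le> R \<Longrightarrow>
      (\<integral>\<^sup>+z. ennreal (indicator (region R) z * \<rho> (fst z)) \<partial>(lebesgue :: (real \<times> (real ^ 'n)) measure))
      \<le> ennreal (D * (R powr (CARD('n) / 2 + \<beta> + 1) * exp (\<Omega> (ln R))))"
    using region_mass by blast
  define e where "e = real CARD('n) / 2 + \<beta> + 1"
  \<comment> \<open>The factor 2 comes from h > R/2 where \<psi>' is nonzero; the powers come from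
    the Hoelder step with mass constant \<open>D\<close>.\<close>
  define A where "A = 2 * ((2 * K) powr p * D powr (p - 1))"
  have A: "A > 0" using K(1) D(1) by (simp add: A_def)
  \<comment> \<open>The power of 1/2 reflects that F is only known to be at least half of \<epsilon>
    J_0.\<close>
  define C where "C = A / (p - 1) * (1 / 2) powr (1 - p)"
  have C: "C > 0" using A p by (simp add: C_def)
  show ?thesis
  proof (rule that[OF R\<^sub>0(1) C])
    fix \<epsilon> T \<tau> and u :: "real \<times> (real ^ 'n) \<Rightarrow> real"
    assume \<epsilon>: "\<epsilon> > 0" and weak: "weak_solution b m p \<epsilon> f g T u"
      and \<tau>: "0 \<le> \<tau>" "ereal \<tau> < T" and R\<tau>: "R\<^sub>0 \<le> 1 + B \<tau>"
    let ?v = "dens u (1 + B \<tau>)"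
    have v: "integrable lebesgue ?v"
      using weak R\<tau> R\<^sub>0 \<tau> by (intro integrable_dens[where T = T] region_subset_cyl[of \<tau>]) (auto simp: weak_solution_def)
    have hm: "(h :: real \<times> (real ^ 'n) \<Rightarrow> real) \<in> borel_measurable lebesgue"
      by (intro measurable_completion) (simp add: measurable_h)
    define F where "F R = (LINT z|lebesgue. ?v z * \<psi> (h z / R)) + \<epsilon> * J\<^sub>0 / 2" for R
    define F' where "F' R = (LINT z|lebesgue. ?v z * (\<psi>' (h z / R) * - (h z / R\<^sup>2)))" for R
    have Fge: "\<epsilon> * J\<^sub>0 / 2 \<le> F R" for R
    proof -
      have "0 \<le> (LINT z|lebesgue. ?v z * \<psi> (h z / R))"
        by (intro integral_nonneg_AE AE_I2 mult_nonneg_nonneg dens_nonneg \<psi>_nonneg)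
      then show ?thesis by (simp add: F_def)
    qed
    have Fpos: "0 < F R" for R using Fge[of R] \<epsilon> J_pos by (smt (verit) half_gt_zero mult_pos_pos)
    have "(\<integral>\<^sup>+R\<in>{R\<^sub>0..1 + B \<tau>}. ennreal (lifespan_weight b m \<beta> T\<^sub>0 p \<theta> R) \<partial>lborel)
        \<le> ennreal (A / (p - 1) * F R\<^sub>0 powr (1 - p))"
    proof (rule nn_integral_le_powr_of_differential_inequality[where F' = F', OF p _ R\<tau>])
      show "0 \<le> A" using A by simp
      show "continuous_on {R\<^sub>0..1 + B \<tau>} F'"
        unfolding F'_def[abs_def] using R\<^sub>0 by (intro continuous_energy_deriv v hm) auto
      fix R assume R: "R\<^sub>0 \<le> R" "R \<le> 1 + B \<tau>"
      then have R1: "1 \<le> R" using R\<^sub>0 by simp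
      show "(F has_real_derivative F' R) (at R)"
        using DERIV_add[OF energy_deriv[OF v hm, of R] DERIV_const, of "\<epsilon> * J\<^sub>0 / 2"] R1
        by (simp add: F_def[abs_def] F'_def)
      show "0 < F R" by (rule Fpos)
      let ?y = "LINT z|lebesgue. ?v z * - \<psi>' (h z / R)"
      let ?E = "exp (\<Omega> (ln R))"
      let ?M = "D * (R powr e * ?E)"
      have M: "?M > 0" using D(1) R1 by simp
      have "(LINT z|lebesgue. indicator (region R) (z :: real \<times> (real ^ 'n)) * \<rho> (fst z)) \<le> ?M"
        using D(2)[OF R1] M by (intro integral_real_bounded) (auto simp: e_def)
      then have bd: "F R \<le> K / R * (l * ?y + l powr (- 1 / (p - 1)) * ?M)" if l: "l > 0" for l
      proof -
        have "F R \<le> (LINT z|lebesgue. ?v z * \<psi> (h z / R)) + \<epsilon> * ?J R"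
        proof -
          have "\<epsilon> * (J\<^sub>0 / 2) \<le> \<epsilon> * ?J R"
            using N[of R] R R\<^sub>0 \<epsilon> by (intro mult_left_mono) auto
          then show ?thesis by (simp add: F_def)
        qed
        also have "\<dots> \<le> K / R * (l * ?y + l powr (- 1 / (p - 1)) *
            (LINT z|lebesgue. indicator (region R) (z :: real \<times> (real ^ 'n)) * \<rho> (fst z)))"
          by (rule K(2)[OF weak \<tau> R1 R(2) l])
        also have "\<dots> \<le> K / R * (l * ?y + l powr (- 1 / (p - 1)) * ?M)"
          using \<open>_ \<le> ?M\<close> K(1) R1 by (intro mult_left_mono add_left_mono) auto
        finally show ?thesis .
      qed
      have Fp: "F R powr p \<le> (2 * K / R) powr p * ?M powr (p - 1) * ?y"
        using R1 by (intro powr_le_of_scaled_bounds p Fpos M K bd) auto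
      have yF': "?y / R \<le> 2 * F' R"
      proof -
        have "?y * (1 / (2 * R)) = (LINT z|lebesgue. ?v z * - \<psi>' (h z / R) * (1 / (2 * R)))"
          by simp
        also have "\<dots> \<le> F' R"
          unfolding F'_def
        proof (rule integral_mono)
          obtain L where L: "\<And>s. \<bar>\<psi>' s\<bar> \<le> L" using \<psi>'_bounded by blast
          have "integrable lebesgue (\<lambda>z. ?v z * - \<psi>' (h z / R))"
            by (rule integrable_dens_mult[OF v, where M = L])
              (simp_all add: L measurable_\<psi>' borel_measurable_uminus)
          then show "integrable lebesgue (\<lambda>z. ?v z * - \<psi>' (h z / R) * (1 / (2 * R)))"
            by (rule integrable_mult_left)
          show "integrable lebesgue (\<lambda>z. ?v z * (\<psi>' (h z / R) * - (h z / R\<^sup>2)))"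
            using R1 by (intro integrable_energy_deriv v hm) simp
          fix z :: "real \<times> (real ^ 'n)"
          \<comment> \<open>Where h/R \<le> 1/2 both sides vanish together with \<psi>'; elsewhere
            h/R^2 exceeds 1/(2R).\<close>
          have "- \<psi>' (h z / R) * (1 / (2 * R)) \<le> - \<psi>' (h z / R) * (h z / R\<^sup>2)"
          proof (cases "h z / R \<le> 1 / 2")
            case True
            then show ?thesis by (simp add: \<psi>'_0)
          next
            case False
            then have "1 / 2 / R \<le> h z / R / R" using R1 by (intro divide_right_mono) auto
            then have "1 / (2 * R) \<le> h z / R\<^sup>2" by (simp add: power2_eq_square)
            then show ?thesis using \<psi>'_nonpos[of "h z / R"] by (intro mult_left_mono) auto
          qed
          then have "?v z * (- \<psi>' (h z / R) * (1 / (2 * R))) \<le> ?v z * (- \<psi>' (h z / R) * (h z / R\<^sup>2))"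
            by (rule mult_left_mono[OF _ dens_nonneg])
          then show "?v z * - \<psi>' (h z / R) * (1 / (2 * R)) \<le> ?v z * (\<psi>' (h z / R) * - (h z / R\<^sup>2))"
            by (simp add: mult.assoc)
        qed
        finally show ?thesis by simp
      qed
      have "lifespan_weight b m \<beta> T\<^sub>0 p \<theta> R * F R powr p
        \<le> lifespan_weight b m \<beta> T\<^sub>0 p \<theta> R * ((2 * K / R) powr p * ?M powr (p - 1) * ?y)"
        by (intro mult_left_mono Fp lifespan_weight_nonneg)
      also have "\<dots> = (2 * K) powr p * D powr (p - 1) * (?y / R)"
      proof -
        have "?M powr (p - 1) = D powr (p - 1) * (R powr (e * (p - 1)) * exp ((p - 1) * \<Omega> (ln R)))"
          using D(1) R1 by (simp add: powr_mult powr_powr exp_powr_real mult.commute)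
        moreover have "(2 * K / R) powr p = (2 * K) powr p * R powr (- p)"
          using K(1) R1 by (simp add: powr_divide powr_minus_divide)
        ultimately have "lifespan_weight b m \<beta> T\<^sub>0 p \<theta> R * ((2 * K / R) powr p * ?M powr (p - 1) * ?y)
          = (2 * K) powr p * D powr (p - 1) * ?y
            * (R powr (- 1 + (p - 1) * \<theta>) * R powr (- p) * R powr (e * (p - 1)))
            * (exp (- (p - 1) * \<Omega> (ln R)) * exp ((p - 1) * \<Omega> (ln R)))"
          by (simp only: lifespan_weight_def mult_ac)
        also have "exp (- (p - 1) * \<Omega> (ln R)) * exp ((p - 1) * \<Omega> (ln R)) = 1"
          by (simp add: exp_add[symmetric] algebra_simps)
        also have "R powr (- 1 + (p - 1) * \<theta>) * R powr (- p) * R powr (e * (p - 1)) = R powr (- 1)"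
        proof -
          \<comment> \<open>The terms n/2 and \<beta> cancel: \<theta> + e = 1/(p-1) + 1 = p/(p-1).
            This is the exponent balance that fixes \<theta>.\<close>
          have "(p - 1) * (\<theta> + e) = p" using p by (simp add: \<theta> e_def distrib_left)
          then have "- 1 + (p - 1) * \<theta> + - p + e * (p - 1) = - 1" by (simp add: algebra_simps)
          then show ?thesis by (simp only: powr_add[symmetric])
        qed
        also have "R powr (- 1) = 1 / R" using R1 by (simp add: powr_minus_divide)
        finally show ?thesis by simp
      qed
      also have "\<dots> \<le> (2 * K) powr p * D powr (p - 1) * (2 * F' R)"
        by (intro mult_left_mono yF') simp
      also have "\<dots> = A * F' R" by (simp add: A_def)
      finally show "0 \<le> lifespan_weight b m \<beta> T\<^sub>0 p \<theta> R \<and>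
          lifespan_weight b m \<beta> T\<^sub>0 p \<theta> R * F R powr p \<le> A * F' R"
        by (simp add: lifespan_weight_nonneg)
    qed
    also have "\<dots> \<le> ennreal (C * (\<epsilon> * J\<^sub>0) powr (- (p - 1)))"
    proof (rule ennreal_leI)
      have "F R\<^sub>0 powr (1 - p) \<le> (\<epsilon> * J\<^sub>0 * (1 / 2)) powr (1 - p)"
        using Fge[of R\<^sub>0] \<epsilon> J_pos p by (intro powr_mono2') auto
      also have "\<dots> = (\<epsilon> * J\<^sub>0) powr (1 - p) * (1 / 2) powr (1 - p)"
        using \<epsilon> J_pos by (intro powr_mult)
      finally have "A / (p - 1) * F R\<^sub>0 powr (1 - p) \<le> A / (p - 1) * ((\<epsilon> * J\<^sub>0) powr (1 - p) * (1 / 2) powr (1 - p))"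
        using A p by (intro mult_left_mono) auto
      then show "A / (p - 1) * F R\<^sub>0 powr (1 - p) \<le> C * (\<epsilon> * J\<^sub>0) powr (- (p - 1))"
        by (simp add: C_def mult_ac)
    qed
    finally show "(\<integral>\<^sup>+R\<in>{R\<^sub>0..1 + B \<tau>}. ennreal (lifespan_weight b m \<beta> T\<^sub>0 p \<theta> R) \<partial>lborel)
      \<le> ennreal (C * (\<epsilon> * J\<^sub>0) powr (- (p - 1)))" .
  qed
qed

end

section \<open>Passage to the full lifespan and to global solutions\<close>

theorem theorem19:
  fixes b m \<rho> :: "real \<Rightarrow> real" and f g :: "real ^ 'n::finite \<Rightarrow> real"
    and p \<beta> T\<^sub>0 \<theta> J\<^sub>0 :: real
  assumes "p > 1"
    and "effective_damping b"
    and "dominated_mass b m"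
    and "mass_balance b m \<beta> T\<^sub>0"
    and "nonoscillation b m"
    and "slow_adjoint_solution b m \<beta> T\<^sub>0 \<rho>"
    and "integrable lebesgue f"
    and "integrable lebesgue g"
    and "J\<^sub>0 = \<rho> 0 * (LINT x|lebesgue. g x)
              + (b 0 * \<rho> 0 - hderiv \<rho> 0) * (LINT x|lebesgue. f x)"
    and "J\<^sub>0 > 0"
    and "\<theta> = 1 / (p - 1) - real CARD('n) / 2 - \<beta>"
    and "\<theta> \<ge> 0"
    and "(\<integral>\<^sup>+R\<in>{2..}. ennreal (lifespan_weight b m \<beta> T\<^sub>0 p \<theta> R) \<partial>lborel) = \<infinity>"
  shows "(\<forall>\<epsilon>>0. \<not> (\<exists>u. weak_solution b m p \<epsilon> f g \<infinity> u)) \<and>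
    (\<exists>R\<^sub>0\<ge>2. \<exists>C>0. \<forall>\<epsilon>>0. \<forall>T>0. \<forall>u. weak_solution b m p \<epsilon> f g (ereal T) u \<longrightarrow>
       1 + Bfun b T \<le> R\<^sub>0 \<or>
       (\<integral>\<^sup>+R\<in>{R\<^sub>0..1 + Bfun b T}. ennreal (lifespan_weight b m \<beta> T\<^sub>0 p \<theta> R) \<partial>lborel)
         \<le> ennreal (C * (\<epsilon> * J\<^sub>0) powr (- (p - 1))))"
proof -
  obtain \<psi> \<psi>' \<psi>'' :: "real \<Rightarrow> real" and K where "test_family b m \<rho> \<psi> \<psi>' \<psi>'' \<beta> T\<^sub>0 p K"
  proof (rule cutoff_exists[OF assms(1)])
    fix \<psi> \<psi>' \<psi>'' :: "real \<Rightarrow> real" and K :: real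
    assume "\<And>s. (\<psi> has_real_derivative \<psi>' s) (at s)" "\<And>s. (\<psi>' has_real_derivative \<psi>'' s) (at s)"
      "continuous_on UNIV \<psi>''"
      "\<And>s. s \<le> 1 / 2 \<Longrightarrow> \<psi> s = 1" "\<And>s. s \<ge> 1 \<Longrightarrow> \<psi> s = 0"
      "\<And>s. s \<le> 1 / 2 \<or> s \<ge> 1 \<Longrightarrow> \<psi>' s = 0" "\<And>s. s \<le> 1 / 2 \<or> s \<ge> 1 \<Longrightarrow> \<psi>'' s = 0"
      "\<And>s. \<psi>' s \<le> 0" "K > 0"
      "\<And>s. \<bar>\<psi>' s\<bar> \<le> K * (- \<psi>' s) powr (1 / p)" "\<And>s. \<bar>\<psi>'' s\<bar> \<le> K * (- \<psi>' s) powr (1 / p)"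
    then have "test_family b m \<rho> \<psi> \<psi>' \<psi>'' \<beta> T\<^sub>0 p K"
      unfolding test_family_def test_family_axioms_def damping_def
      by (intro conjI allI impI assms)
    then show ?thesis by (rule that)
  qed
  then interpret test_family b m \<rho> \<psi> \<psi>' \<psi>'' \<beta> T\<^sub>0 p K .
  obtain R\<^sub>0 C where R\<^sub>0: "R\<^sub>0 \<ge> 2" and C: "C > 0" and
    bound: "\<And>\<epsilon> T \<tau> u. \<lbrakk>\<epsilon> > 0; weak_solution b m p \<epsilon> f g T u; 0 \<le> \<tau>; ereal \<tau> < T; R\<^sub>0 \<le> 1 + B \<tau>\<rbrakk> \<Longrightarrow>
      (\<integral>\<^sup>+R\<in>{R\<^sub>0..1 + B \<tau>}. ennreal (lifespan_weight b m \<beta> T\<^sub>0 p \<theta> R) \<partial>lborel)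
      \<le> ennreal (C * (\<epsilon> * J\<^sub>0) powr (- (p - 1)))"
    using lifespan_integral_bound[OF assms(7-11)] by blast
  \<comment> \<open>Restricting to radii at least 1 makes the weight Borel measurable without
    changing it on the intervals that occur.\<close>
  define W where "W R = ennreal (indicator {1..} R * lifespan_weight b m \<beta> T\<^sub>0 p \<theta> R)" for R
  have W_meas: "W \<in> borel_measurable borel"
    unfolding W_def[abs_def] using measurable_lifespan_weight by simp
  have W_eq: "(\<integral>\<^sup>+R\<in>S. ennreal (lifespan_weight b m \<beta> T\<^sub>0 p \<theta> R) \<partial>lborel) = (\<integral>\<^sup>+R\<in>S. W R \<partial>lborel)"
    if "S \<subseteq> {1..}" for S
  proof (rule nn_integral_cong)
    fix R
    show "ennreal (lifespan_weight b m \<beta> T\<^sub>0 p \<theta> R) * indicator S R = W R * indicator S R"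
    proof (cases "R \<in> S")
      case True
      then have "R \<in> {1..}" using that by blast
      then show ?thesis by (simp add: W_def)
    qed simp
  qed
  \<comment> \<open>The upper limit is now an arbitrary radius whose terminal time lies before
    \<open>T\<close>; for \<open>c\<close> below \<open>R\<^sub>0\<close> the interval is
    empty.\<close>
  have Icc: "(\<integral>\<^sup>+R\<in>{R\<^sub>0..c}. W R \<partial>lborel) \<le> ennreal (C * (\<epsilon> * J\<^sub>0) powr (- (p - 1)))"
    if "\<epsilon> > 0" "weak_solution b m p \<epsilon> f g T u" "\<And>\<tau>. 0 \<le> \<tau> \<Longrightarrow> 1 + B \<tau> = c \<Longrightarrow> ereal \<tau> < T" for \<epsilon> T u c
  proof (cases "R\<^sub>0 \<le> c")
    case True
    then have "1 \<le> c" using R\<^sub>0 by simp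
    then obtain \<tau> where \<tau>: "0 \<le> \<tau>" "1 + B \<tau> = c" by (rule B_surj)
    have "(\<integral>\<^sup>+R\<in>{R\<^sub>0..c}. ennreal (lifespan_weight b m \<beta> T\<^sub>0 p \<theta> R) \<partial>lborel)
      \<le> ennreal (C * (\<epsilon> * J\<^sub>0) powr (- (p - 1)))"
      using bound[OF that(1,2) \<tau>(1) that(3)[OF \<tau>]] True \<tau>(2) by simp
    moreover have "{R\<^sub>0..c} \<subseteq> {1..}" using R\<^sub>0 by auto
    ultimately show ?thesis by (simp only: W_eq)
  qed simp
  show ?thesis
  proof (intro conjI allI impI notI)
    fix \<epsilon> :: real assume \<epsilon>: "\<epsilon> > 0" and "\<exists>u. weak_solution b m p \<epsilon> f g \<infinity> u"
    then obtain u where u: "weak_solution b m p \<epsilon> f g \<infinity> u" by blast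
    let ?L = "ennreal (C * (\<epsilon> * J\<^sub>0) powr (- (p - 1)))"
    have "(\<integral>\<^sup>+R\<in>(\<Union>k. {R\<^sub>0..R\<^sub>0 + real k}). W R \<partial>lborel) \<le> ?L"
    proof (rule nn_integral_UN_Icc_le[OF W_meas])
      show "(\<integral>\<^sup>+R\<in>{R\<^sub>0..R\<^sub>0 + real k}. W R \<partial>lborel) \<le> ?L" for k
        by (rule Icc[OF \<epsilon> u]) simp
    qed (simp add: incseq_def)
    also have "(\<Union>k. {R\<^sub>0..R\<^sub>0 + real k}) = {R\<^sub>0..}"
    proof (intro equalityI subsetI)
      fix x assume "x \<in> {R\<^sub>0..}"
      moreover obtain k :: nat where "x - R\<^sub>0 \<le> real k" using real_arch_simple by blast
      ultimately show "x \<in> (\<Union>k. {R\<^sub>0..R\<^sub>0 + real k})" by (auto intro!: exI[of _ k])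
    qed auto
    finally have tail: "(\<integral>\<^sup>+R\<in>{R\<^sub>0..}. W R \<partial>lborel) \<le> ?L" .
    \<comment> \<open>The exponent of the weight may be negative; its absolute value gives a bound
      on [2, \<open>R\<^sub>0\<close>] in either case. Divergence is assumed from 2 on, so this head
      has to be finite before the tail can be contradicted.\<close>
    define e where "e = \<bar>- 1 + (p - 1) * \<theta>\<bar>"
    have W_le: "W R \<le> ennreal (R\<^sub>0 powr e)" if R: "R \<in> {2..R\<^sub>0}" for R
    proof -
      have "R powr (- 1 + (p - 1) * \<theta>) \<le> R powr e" using R by (intro powr_mono) (auto simp: e_def)
      also have "\<dots> \<le> R\<^sub>0 powr e" using R by (intro powr_mono2) (auto simp: e_def)
      finally have "R powr (- 1 + (p - 1) * \<theta>) \<le> R\<^sub>0 powr e" .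
      moreover have "exp (- (p - 1) * \<Omega> (ln R)) \<le> 1"
        using \<Omega>_nonneg[of "ln R"] R assms(1) by (simp add: mult_nonpos_nonneg)
      ultimately have "lifespan_weight b m \<beta> T\<^sub>0 p \<theta> R \<le> R\<^sub>0 powr e * 1"
        unfolding lifespan_weight_def by (intro mult_mono) auto
      then show ?thesis using R by (auto simp: W_def intro!: ennreal_leI)
    qed
    have "(\<integral>\<^sup>+R\<in>{2..R\<^sub>0}. W R \<partial>lborel) \<le> (\<integral>\<^sup>+R\<in>{2..R\<^sub>0}. ennreal (R\<^sub>0 powr e) \<partial>lborel)"
      using W_le by (intro nn_integral_mono) (auto simp: indicator_def)
    also have "\<dots> = ennreal (R\<^sub>0 powr e) * ennreal (R\<^sub>0 - 2)"
      using R\<^sub>0 by (simp add: nn_integral_cmult_indicator)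
    also have "\<dots> < \<infinity>" by (simp add: ennreal_mult_less_top)
    finally have head: "(\<integral>\<^sup>+R\<in>{2..R\<^sub>0}. W R \<partial>lborel) < \<infinity>" .
    have "\<infinity> = (\<integral>\<^sup>+R\<in>{2..}. W R \<partial>lborel)"
      using assms(13) W_eq[of "{2..}"] by auto
    also have "\<dots> \<le> (\<integral>\<^sup>+R. W R * indicator {2..R\<^sub>0} R + W R * indicator {R\<^sub>0..} R \<partial>lborel)"
      by (intro nn_integral_mono) (auto simp: indicator_def)
    also have "\<dots> = (\<integral>\<^sup>+R\<in>{2..R\<^sub>0}. W R \<partial>lborel) + (\<integral>\<^sup>+R\<in>{R\<^sub>0..}. W R \<partial>lborel)"
      using W_meas by (intro nn_integral_add) auto
    also have "\<dots> < \<infinity>"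
      using head le_less_trans[OF tail, of \<infinity>] by (simp add: ennreal_add_less_top)
    finally show False by simp
  next
    show "\<exists>R\<^sub>0\<ge>2. \<exists>C>0. \<forall>\<epsilon>>0. \<forall>T>0. \<forall>u. weak_solution b m p \<epsilon> f g (ereal T) u \<longrightarrow>
       1 + Bfun b T \<le> R\<^sub>0 \<or>
       (\<integral>\<^sup>+R\<in>{R\<^sub>0..1 + Bfun b T}. ennreal (lifespan_weight b m \<beta> T\<^sub>0 p \<theta> R) \<partial>lborel)
         \<le> ennreal (C * (\<epsilon> * J\<^sub>0) powr (- (p - 1)))"
    proof (rule exI[of _ R\<^sub>0], intro conjI R\<^sub>0, rule exI[of _ C], intro conjI C allI impI iffD2[OF disj_imp])
      fix \<epsilon> T :: real and u
      assume \<epsilon>: "\<epsilon> > 0" and T: "T > 0" and u: "weak_solution b m p \<epsilon> f g (ereal T) u"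
        and "\<not> 1 + B T \<le> R\<^sub>0"
      then have d: "R\<^sub>0 < 1 + B T" by simp
      let ?L = "ennreal (C * (\<epsilon> * J\<^sub>0) powr (- (p - 1)))"
      let ?d = "1 + B T - R\<^sub>0"
      \<comment> \<open>The radii start at \<open>R\<^sub>0\<close> for k = 0 and increase to 1 +
        B(T) without reaching it, so their terminal times lie before T. The shift by
        \<open>Suc\<close> avoids division by 0.\<close>
      let ?c = "\<lambda>k. 1 + B T - ?d / real (Suc k)"
      have early: "ereal \<tau> < ereal T" if "0 \<le> \<tau>" "1 + B \<tau> = c" "c < 1 + B T" for \<tau> c
      proof (rule ccontr)
        assume "\<not> ereal \<tau> < ereal T"
        then have "B T \<le> B \<tau>" using T by (intro B_mono) auto
        then show False using that by simp
      qed
      have c_less: "?c k < 1 + B T" for k using d by simp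
      have "(\<integral>\<^sup>+R\<in>(\<Union>k. {R\<^sub>0..?c k}). W R \<partial>lborel) \<le> ?L"
      proof (rule nn_integral_UN_Icc_le[OF W_meas])
        show "incseq ?c" unfolding incseq_def using d by (auto intro!: divide_left_mono)
        show "(\<integral>\<^sup>+R\<in>{R\<^sub>0..?c k}. W R \<partial>lborel) \<le> ?L" for k
          by (rule Icc[OF \<epsilon> u early[OF _ _ c_less]])
      qed
      also have "(\<Union>k. {R\<^sub>0..?c k}) = {R\<^sub>0..<1 + B T}"
      proof (intro equalityI subsetI)
        fix x assume x: "x \<in> {R\<^sub>0..<1 + B T}"
        obtain k :: nat where k: "?d / (1 + B T - x) \<le> real k" using real_arch_simple by blast
        have "?d \<le> real k * (1 + B T - x)" using k x by (simp add: pos_divide_le_eq)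
        also have "\<dots> \<le> real (Suc k) * (1 + B T - x)" using x by (intro mult_right_mono) auto
        finally have "?d / real (Suc k) \<le> 1 + B T - x" by (simp add: pos_divide_le_eq mult.commute del: of_nat_Suc)
        then have "x \<in> {R\<^sub>0..?c k}" using x by (simp del: of_nat_Suc)
        then show "x \<in> (\<Union>k. {R\<^sub>0..?c k})" by blast
      next
        fix x assume "x \<in> (\<Union>k. {R\<^sub>0..?c k})"
        then obtain k where "R\<^sub>0 \<le> x" "x \<le> ?c k" by auto
        then show "x \<in> {R\<^sub>0..<1 + B T}" using c_less[of k] by simp
      qed
      \<comment> \<open>The end point 1 + B(T), missed by the union, is a null set.\<close>
      also have "(\<integral>\<^sup>+R\<in>{R\<^sub>0..<1 + B T}. W R \<partial>lborel) = (\<integral>\<^sup>+R\<in>{R\<^sub>0..1 + B T}. W R \<partial>lborel)"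
        using AE_lborel_singleton[of "1 + B T"]
        by (intro nn_integral_cong_AE) (auto elim!: eventually_mono simp: indicator_def)
      finally show "(\<integral>\<^sup>+R\<in>{R\<^sub>0..1 + B T}. ennreal (lifespan_weight b m \<beta> T\<^sub>0 p \<theta> R) \<partial>lborel) \<le> ?L"
        using W_eq[of "{R\<^sub>0..1 + B T}"] R\<^sub>0 by auto
    qed
  qed
qed

end
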